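(* Let $p>2$, $R>0$, and let $M$ be a smooth, compact, oriented surface with boundary, immersed in $\mathbb{R}^3$, containing the origin, with $\partial M\subset\partial B_R(0)$, and such that \[ \int_M|A|^2\,d\mathcal{H}^2\le c_1 r^2\quad\text{and}\quad \|H\|_{L^p(M\cap B_R)}R^{\frac{p-2}{p}}\le c_2 r \] for some $r\in[0,\frac{1}{\sqrt3}]$, where $B_R=B_R(0)$. If $M_R$ is a connected component of $M\cap B_{\frac{\beta R}{2}}(0)$ containing the origin, then, after a rotation of $\mathbb{R}^3$, \[ \sup_{M_R}g\le r . \] Here $c_1$, $c_2=c_2(p)$ and $\beta$ are the constants fixed in the context.
   Context: For an oriented surface $M$ immersed in $\mathbb{R}^3$: $\mathcal{B}_R(x)$ is the intrinsic open ball of $M$ of radius $R$ centered at $x\in M$, and $B_R(x)$ is the extrinsic (Euclidean) open ball in $\mathbb{R}^3$; $k_1,k_2$ are the principal curvatures; $|A|=\sqrt{k_1^2+k_2^2}$; $H=k_1+k_2$ is the mean curvature; $\mathcal{H}^2$ is two-dimensional Hausdorff measure (area on $M$). $\nu\colon M\to S^2$ is the Gauss map, $e_3=(0,0,1)$, and $g(x)=\sqrt{1-\nu(x)\cdot e_3}=\frac{1}{\sqrt2}|\nu(x)-e_3|$. "After a rotation" means that the conclusion holds for the image of $M$ under a suitable rotation of $\mathbb{R}^3$. Since $M$ is only immersed, intersections of $M$ with subsets of $\mathbb{R}^3$ are understood as preimages under the immersion; "containing the origin" means containing a preimage of the origin. Constants: $c_1>0$, $\beta\in(0,\frac12)$ (absolute)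 and $c_2=c_2(p)>0$ (for each $p>2$) are fixed constants with the following property: if $M$ is a smooth, compact, oriented surface with boundary immersed in $\mathbb{R}^3$ and $\mathcal{B}_R(x_0)\subset M\setminus\partial M$ satisfies $\int_{\mathcal{B}_R(x_0)}|A|^2\,d\mathcal{H}^2\le c_1r^2$ and $\|H\|_{L^p(\mathcal{B}_R(x_0))}R^{\frac{p-2}{p}}\le c_2r$ for some $r\in[0,1]$, then, after a rotation, $\sup_{\mathcal{B}_{\beta R}(x_0)}g\le r$. (Such constants exist.) *)

theory Defs
  imports "HOL-Analysis.Analysis"
begin

subsection \<open>Smooth maps\<close>

(* Intended for open W. *)
primrec Ck_on :: "nat \<Rightarrow> 'a::euclidean_space set \<Rightarrow> ('a \<Rightarrow> 'b::euclidean_space) \<Rightarrow> bool" where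
  "Ck_on 0 W f \<longleftrightarrow> continuous_on W f"
| "Ck_on (Suc k) W f \<longleftrightarrow>
     f differentiable_on W \<and> (\<forall>v. Ck_on k W (\<lambda>x. frechet_derivative f (at x) v))"

(* S need not be open: f is smooth if it extends smoothly near every point of S. *)
definition smooth_on :: "'a::euclidean_space set \<Rightarrow> ('a \<Rightarrow> 'b::euclidean_space) \<Rightarrow> bool" where
  "smooth_on S f \<longleftrightarrow>
     (\<forall>x\<in>S. \<exists>W h. open W \<and> x \<in> W \<and> (\<forall>k. Ck_on k W h) \<and> (\<forall>y\<in>S \<inter> W. h y = f y))"


subsection \<open>Oriented surfaces with boundary immersed in Euclidean space\<close>

definition half_plane :: "(real^2) set" where
  "half_plane = {v. 0 \<le> v $ 2}"

(* A chart (U, \<phi>) has domain U; the values of \<phi> outside U are irrelevant. *)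
type_synonym 'a chart = "'a set \<times> ('a \<Rightarrow> real^2)"

definition chart_image :: "'a chart \<Rightarrow> (real^2) set" where
  "chart_image c = snd c ` fst c"

definition is_chart :: "'a topology \<Rightarrow> 'a chart \<Rightarrow> bool" where
  "is_chart T c \<longleftrightarrow>
     openin T (fst c) \<and>
     openin (top_of_set half_plane) (chart_image c) \<and>
     homeomorphic_map (subtopology T (fst c)) (top_of_set (chart_image c)) (snd c)"

definition in_chart :: "('a \<Rightarrow> 'b) \<Rightarrow> 'a chart \<Rightarrow> real^2 \<Rightarrow> 'b" where
  "in_chart f c = f \<circ> inv_into (fst c) (snd c)"

definition oriented_compatible :: "'a chart \<Rightarrow> 'a chart \<Rightarrow> bool" where
  "oriented_compatible c d \<longleftrightarrow>
     (let S = snd c ` (fst c \<inter> fst d); \<tau> = in_chart (snd d) c in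
       smooth_on S \<tau> \<and>
       (\<forall>v\<in>S. det (matrix (frechet_derivative \<tau> (at v within S))) > 0))"

(* The points carry an abstract topology; immersion is only relevant on the points. *)
record 'a surface =
  points :: "'a topology"
  atlas :: "'a chart set"
  immersion :: "'a \<Rightarrow> real^3"

(* Smooth oriented surface with (possibly empty) boundary and its smooth immersion.
   Derivatives at boundary points are taken within the chart image; they are well defined
   because the chart image is relatively open in the half plane. *)
definition immersed_surface :: "'a surface \<Rightarrow> bool" where
  "immersed_surface M \<longleftrightarrow>
     Hausdorff_space (points M) \<and> second_countable (points M) \<and>
     (\<forall>c\<in>atlas M. is_chart (points M) c) \<and>
     (\<Union>c\<in>atlas M. fst c) = topspace (points M) \<and>
     (\<forall>c\<in>atlas M. \<forall>d\<in>atlas M. oriented_compatible c d) \<and>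
     (\<forall>c\<in>atlas M.
        smooth_on (chart_image c) (in_chart (immersion M) c) \<and>
        (\<forall>v\<in>chart_image c.
           inj (frechet_derivative (in_chart (immersion M) c) (at v within chart_image c))))"

definition compact_immersed_surface :: "'a surface \<Rightarrow> bool" where
  "compact_immersed_surface M \<longleftrightarrow> immersed_surface M \<and> compact_space (points M)"

definition surface_boundary :: "'a surface \<Rightarrow> 'a set" where
  "surface_boundary M =
     {x \<in> topspace (points M). \<exists>c\<in>atlas M. x \<in> fst c \<and> snd c x $ 2 = 0}"

definition surface_preimage :: "'a surface \<Rightarrow> (real^3) set \<Rightarrow> 'a set" where
  "surface_preimage M B = {x \<in> topspace (points M). immersion M x \<in> B}"

definition rotate_surface :: "real^3^3 \<Rightarrow> 'a surface \<Rightarrow> 'a surface" where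
  "rotate_surface Q M = M\<lparr>immersion := (\<lambda>x. Q *v immersion M x)\<rparr>"


subsection \<open>Gauss map and curvatures\<close>

definition chart_at :: "'a surface \<Rightarrow> 'a \<Rightarrow> 'a chart" where
  "chart_at M x = (SOME c. c \<in> atlas M \<and> x \<in> fst c)"

(* The differential of f at x in the coordinates of chart_at M x. *)
definition surface_deriv ::
    "'a surface \<Rightarrow> ('a \<Rightarrow> 'b::euclidean_space) \<Rightarrow> 'a \<Rightarrow> real^2 \<Rightarrow> 'b" where
  "surface_deriv M f x =
     (let c = chart_at M x in
       frechet_derivative (in_chart f c) (at (snd c x) within chart_image c))"

(* Independent of the chart, since the atlas is oriented. *)
definition gauss_map :: "'a surface \<Rightarrow> 'a \<Rightarrow> real^3" where
  "gauss_map M x =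
     (let n = cross3 (surface_deriv M (immersion M) x (axis 1 1))
                     (surface_deriv M (immersion M) x (axis 2 1))
      in n /\<^sub>R norm n)"

(* Eigenvalues of the shape operator -d\<nu>, tangent vectors being identified with
   their images under the differential of the immersion. *)
definition principal_curvatures :: "'a surface \<Rightarrow> 'a \<Rightarrow> real set" where
  "principal_curvatures M x =
     {k. \<exists>v. v \<noteq> 0 \<and>
        - surface_deriv M (gauss_map M) x v = k *\<^sub>R surface_deriv M (immersion M) x v}"

(* The shape operator is self-adjoint on a two-dimensional space, so the least and the
   greatest eigenvalue are its two eigenvalues counted with multiplicity. *)
definition curv1 :: "'a surface \<Rightarrow> 'a \<Rightarrow> real" where
  "curv1 M x = Min (principal_curvatures M x)"

definition curv2 :: "'a surface \<Rightarrow> 'a \<Rightarrow> real" where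
  "curv2 M x = Max (principal_curvatures M x)"

definition norm_A :: "'a surface \<Rightarrow> 'a \<Rightarrow> real" where
  "norm_A M x = sqrt ((curv1 M x)\<^sup>2 + (curv2 M x)\<^sup>2)"

definition mean_curv :: "'a surface \<Rightarrow> 'a \<Rightarrow> real" where
  "mean_curv M x = curv1 M x + curv2 M x"

definition e3 :: "real^3" where
  "e3 = vector [0, 0, 1]"

definition tilt :: "'a surface \<Rightarrow> 'a \<Rightarrow> real" where
  "tilt M x = sqrt (1 - gauss_map M x \<bullet> e3)"


subsection \<open>Intrinsic distance\<close>

(* Since the immersion is locally a smooth embedding, a path in M is piecewise C1 iff it
   is continuous and its image is piecewise C1. *)
definition surface_path :: "'a surface \<Rightarrow> (real \<Rightarrow> 'a) \<Rightarrow> 'a \<Rightarrow> 'a \<Rightarrow> bool" where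
  "surface_path M \<gamma> x y \<longleftrightarrow>
     pathin (points M) \<gamma> \<and> \<gamma> 0 = x \<and> \<gamma> 1 = y \<and>
     (immersion M \<circ> \<gamma>) piecewise_C1_differentiable_on {0..1}"

definition surface_path_length :: "'a surface \<Rightarrow> (real \<Rightarrow> 'a) \<Rightarrow> ennreal" where
  "surface_path_length M \<gamma> =
     (\<integral>\<^sup>+t\<in>{0..1}. ennreal (norm (vector_derivative (immersion M \<circ> \<gamma>) (at t))) \<partial>lborel)"

(* Infinite between different components. *)
definition intrinsic_dist :: "'a surface \<Rightarrow> 'a \<Rightarrow> 'a \<Rightarrow> ennreal" where
  "intrinsic_dist M x y = (INF \<gamma>\<in>{\<gamma>. surface_path M \<gamma> x y}. surface_path_length M \<gamma>)"

definition intrinsic_ball :: "'a surface \<Rightarrow> 'a \<Rightarrow> real \<Rightarrow> 'a set" where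
  "intrinsic_ball M x R = {y \<in> topspace (points M). intrinsic_dist M x y < ennreal R}"


subsection \<open>Two-dimensional Hausdorff measure\<close>

definition ediam :: "('a \<Rightarrow> 'a \<Rightarrow> ennreal) \<Rightarrow> 'a set \<Rightarrow> ennreal" where
  "ediam d A = (SUP x\<in>A. SUP y\<in>A. d x y)"

definition hausdorff2_pre :: "'a set \<Rightarrow> ('a \<Rightarrow> 'a \<Rightarrow> ennreal) \<Rightarrow> ennreal \<Rightarrow> 'a set \<Rightarrow> ennreal" where
  "hausdorff2_pre X d \<delta> A =
     (INF C\<in>{C :: nat \<Rightarrow> 'a set. A \<subseteq> (\<Union>n. C n) \<and> (\<forall>n. C n \<subseteq> X \<and> ediam d (C n) \<le> \<delta>)}.
        \<Sum>n. ennreal pi * (ediam d (C n) / 2)\<^sup>2)"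

definition hausdorff2_outer :: "'a set \<Rightarrow> ('a \<Rightarrow> 'a \<Rightarrow> ennreal) \<Rightarrow> 'a set \<Rightarrow> ennreal" where
  "hausdorff2_outer X d A = (SUP \<delta>\<in>{0<..}. hausdorff2_pre X d \<delta> A)"

(* Restricted to the Caratheodory-measurable sets, which include the Borel sets. *)
definition hausdorff2 :: "'a set \<Rightarrow> ('a \<Rightarrow> 'a \<Rightarrow> ennreal) \<Rightarrow> 'a measure" where
  "hausdorff2 X d =
     measure_of X (lambda_system X (Pow X) (hausdorff2_outer X d)) (hausdorff2_outer X d)"

definition area :: "'a surface \<Rightarrow> 'a measure" where
  "area M = hausdorff2 (topspace (points M)) (intrinsic_dist M)"

definition integral_A_sq :: "'a surface \<Rightarrow> 'a set \<Rightarrow> ennreal" where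
  "integral_A_sq M S = (\<integral>\<^sup>+x\<in>S. ennreal ((norm_A M x)\<^sup>2) \<partial>area M)"

definition Lp_norm_H :: "'a surface \<Rightarrow> real \<Rightarrow> 'a set \<Rightarrow> ennreal" where
  "Lp_norm_H M p S =
     (let I = (\<integral>\<^sup>+x\<in>S. ennreal (\<bar>mean_curv M x\<bar> powr p) \<partial>area M)
      in if I = \<infinity> then \<infinity> else ennreal (enn2real I powr (1 / p)))"

end

(* The intrinsic ball B_R(x0) about a preimage x0 of the origin misses the boundary, since the immersion F
   does not increase distances, so the constants c1, c2 give a rotation Q with g <= r <= 1/sqrt 3 on
   B_{\<beta>R}(x0).  There the unit normal has third coordinate >= 2/3, hence tangent vectors are at most
   3/2 times as long as their projections to the horizontal plane, and the projection h of Q o F is a local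
   homeomorphism whose local sections are 3/2-Lipschitz into the intrinsic distance.  The section of h
   through x0 therefore extends over the open disc of radius \<beta>R/2 without leaving the compact set of
   points at intrinsic distance <= 3/4 \<beta>R.  Inside the preimage of that disc, the image of a continuous
   section is open and closed, so it contains the connected set M_R, and M_R lies in B_{\<beta>R}(x0). *)
theory Submission
  imports Defs
begin

subsection \<open>Path length and the intrinsic distance\<close>

text \<open>The obstacle: \<open>M\<^sub>R\<close> is cut out by extrinsic nearness, and curves
  inside it come with no length bound, so they give no control of intrinsic distance. The short
  curves are lifts of straight segments of the horizontal plane. The tilt is known to be small only
  inside the intrinsic ball, and a lift could run out of that region before its segment ends. This
  is excluded by an estimate carried along the construction: the lift of a radius of length t has
  length at most 3/2 t. On the disc of radius half that of the intrinsic ball the lift therefore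
  stays strictly inside the ball, since 3/2 < 2; this is what the factor 1/2 in the radius of the
  extrinsic ball pays for. Compactness then supplies one size of local section valid at all points
  reached, so the disc grows by fixed steps and finitely many suffice. The constant 3/2 is the
  reciprocal of 2/3 = 1 - (1/sqrt 3)^2. The rotation is built into the projection rather than
  applied to the surface, so all lengths and distances remain those of \<open>M\<close>; the rotated
  surface enters only through its tilt.\<close>

definition path_length :: "(real \<Rightarrow> 'a::euclidean_space) \<Rightarrow> ennreal" where
  "path_length g = (\<integral>\<^sup>+t\<in>{0..1}. ennreal (norm (vector_derivative g (at t))) \<partial>lborel)"

lemma surface_path_length_eq: "surface_path_length M \<gamma> = path_length (immersion M \<circ> \<gamma>)"
  by (simp add: surface_path_length_def path_length_def)

text \<open>\<open>vector_derivative\<close> is controlled only where the curve is differentiable.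
  The finite set \<open>S\<close> is Lebesgue null, so any \<open>D\<close> that is right elsewhere
  gives the length; vanishing outside the unit interval absorbs the indicator.\<close>

lemma path_length_eqI:
  assumes "finite S"
    and "\<And>t. t \<in> {0..1} - S \<Longrightarrow> (g has_vector_derivative D t) (at t)"
    and "\<And>t. t \<notin> {0..1} \<Longrightarrow> D t = 0"
  shows "path_length g = (\<integral>\<^sup>+t. ennreal (norm (D t)) \<partial>lborel)"
  unfolding path_length_def
proof (rule nn_integral_cong_AE)
  have "AE t in lborel. t \<notin> S"
    using assms(1) by (intro AE_not_in countable_imp_null_set_lborel) (auto simp: countable_finite)
  then show "AE t in lborel. ennreal (norm (vector_derivative g (at t))) * indicator {0..1} t
      = ennreal (norm (D t))"
    proof eventually_elim
    case (elim t)
    then show ?case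
      using assms(3)[of t] vector_derivative_at[OF assms(2)[of t]] by (auto simp: indicator_def)
  qed
qed

text \<open>A derivative that is continuous off a finite set becomes a Borel function on the whole
  line once it is set to 0 on that set and outside the unit interval. Length computations use this
  \<open>D\<close> in place of \<open>vector_derivative\<close>.\<close>

lemma valid_path_derivative:
  fixes g :: "real \<Rightarrow> 'a::euclidean_space"
  assumes "valid_path g"
  obtains S D where "finite S" "D \<in> borel_measurable borel"
    "\<And>t. t \<in> {0..1} - S \<Longrightarrow> (g has_vector_derivative D t) (at t)"
    "\<And>t. t \<notin> {0..1} - S \<Longrightarrow> D t = 0"
    "path_length g = (\<integral>\<^sup>+t. ennreal (norm (D t)) \<partial>lborel)"
proof -
  obtain S D where S: "finite S"
    and D: "\<And>t. t \<in> {0..1} - S \<Longrightarrow> (g has_vector_derivative D t) (at t)"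
    and cont: "continuous_on ({0..1} - S) D"
    using assms unfolding valid_path_def piecewise_C1_differentiable_on_def C1_differentiable_on_def
    by metis
  define D' where "D' t = indicator ({0..1} - S) t *\<^sub>R D t" for t
  have "({0..1} - S) \<in> sets borel"
    using S by (intro sets.Diff) (auto intro!: borel_closed finite_imp_closed)
  then have "D' \<in> borel_measurable borel"
    unfolding D'_def using cont by (intro borel_measurable_continuous_on_indicator)
  moreover have D': "(g has_vector_derivative D' t) (at t)" if "t \<in> {0..1} - S" for t
    using D that by (auto simp: D'_def)
  ultimately show ?thesis
    using S by (intro that[of S D'] path_length_eqI[of S]) (auto simp: D'_def)
qed

text \<open>The fundamental theorem of calculus with finitely many exceptional points, followed by
  moving the norm inside the integral. Finite length makes \<open>D\<close> Lebesgue integrable, so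
  its gauge and Lebesgue integrals agree.\<close>

lemma norm_diff_le_path_length:
  fixes g :: "real \<Rightarrow> 'a::euclidean_space"
  assumes "valid_path g"
  shows "ennreal (norm (g 1 - g 0)) \<le> path_length g"
proof (cases "path_length g = \<infinity>")
  case False
  obtain S D where S: "finite S" and meas: "D \<in> borel_measurable borel"
    and D: "\<And>t. t \<in> {0..1} - S \<Longrightarrow> (g has_vector_derivative D t) (at t)"
    and D0: "\<And>t. t \<notin> {0..1} - S \<Longrightarrow> D t = 0"
    and len: "path_length g = (\<integral>\<^sup>+t. ennreal (norm (D t)) \<partial>lborel)"
    using valid_path_derivative[OF assms] by metis
  have int: "integrable lborel D"
    using False len meas by (intro integrableI_bounded) (auto simp: less_top)
  have "continuous_on {0..1} g"
    using assms by (auto simp: valid_path_def piecewise_C1_differentiable_on_def)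
  then have "(D has_integral (g 1 - g 0)) {0..1}"
    using S D by (intro fundamental_theorem_of_calculus_strong) auto
  then have "((\<lambda>t. if t \<in> {0..1} then D t else 0) has_integral (g 1 - g 0)) UNIV"
    by (simp only: has_integral_restrict_UNIV)
  moreover have "(\<lambda>t. if t \<in> {0..1} then D t else 0) = D"
  proof
    fix t show "(if t \<in> {0..1} then D t else 0) = D t"
      using D0[of t] by auto
  qed
  ultimately have "(D has_integral (g 1 - g 0)) UNIV"
    by simp
  with has_integral_integral_lborel[OF int] have "g 1 - g 0 = integral\<^sup>L lborel D"
    by (rule has_integral_unique[rotated])
  then have "ennreal (norm (g 1 - g 0)) \<le> ennreal (LINT t|lborel. norm (D t))"
    by (simp add: integral_norm_bound ennreal_leI)
  also have "\<dots> = path_length g"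
    unfolding len using int by (simp add: nn_integral_eq_integral)
  finally show ?thesis .
qed auto

lemma path_length_join:
  fixes g1 g2 :: "real \<Rightarrow> 'a::euclidean_space"
  assumes "valid_path g1" "valid_path g2"
  shows "path_length (g1 +++ g2) = path_length g1 + path_length g2"
proof -
  obtain S1 D1 where S1: "finite S1" and meas1[measurable]: "D1 \<in> borel_measurable borel"
    and D1: "\<And>t. t \<in> {0..1} - S1 \<Longrightarrow> (g1 has_vector_derivative D1 t) (at t)"
    and z1: "\<And>t. t \<notin> {0..1} - S1 \<Longrightarrow> D1 t = 0"
    and len1: "path_length g1 = (\<integral>\<^sup>+t. ennreal (norm (D1 t)) \<partial>lborel)"
    using valid_path_derivative[OF assms(1)] by metis
  obtain S2 D2 where S2: "finite S2" and meas2[measurable]: "D2 \<in> borel_measurable borel"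
    and D2: "\<And>t. t \<in> {0..1} - S2 \<Longrightarrow> (g2 has_vector_derivative D2 t) (at t)"
    and z2: "\<And>t. t \<notin> {0..1} - S2 \<Longrightarrow> D2 t = 0"
    and len2: "path_length g2 = (\<integral>\<^sup>+t. ennreal (norm (D2 t)) \<partial>lborel)"
    using valid_path_derivative[OF assms(2)] by metis
  \<comment> \<open>Each half runs at double speed. The value at 1/2 is arbitrary, since that point
    is put into \<open>S\<close>.\<close>
  define D where "D t = (if t < 1/2 then 2 *\<^sub>R D1 (2*t) else if t > 1/2 then 2 *\<^sub>R D2 (2*t-1) else 0)" for t
  define S where "S = (\<lambda>x. x/2) ` S1 \<union> (\<lambda>x. (x+1)/2) ` S2 \<union> {1/2}"
  have "finite S"
    using S1 S2 by (simp add: S_def)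
  moreover have "((g1 +++ g2) has_vector_derivative D t) (at t)" if t: "t \<in> {0..1} - S" for t
  proof (cases "t < 1/2")
    case True
    have "2*t \<notin> S1"
    proof
      assume "2*t \<in> S1"
      then have "2*t/2 \<in> S"
        unfolding S_def by blast
      with t show False by simp
    qed
    then have "(g1 has_vector_derivative D1 (2*t)) (at (2*t))"
      using t True by (intro D1) auto
    then have "(g1 \<circ> (\<lambda>t. 2*t) has_vector_derivative 2 *\<^sub>R D1 (2*t)) (at t)"
      by (intro vector_diff_chain_at) (auto intro!: derivative_eq_intros)
    then show ?thesis
      unfolding D_def using True
      by (auto intro: has_vector_derivative_transform_within_open[where S="{..<1/2}"]
          simp: joinpaths_def)
  next
    case False
    then have t2: "t > 1/2"
      using t by (auto simp: S_def)
    have "2*t-1 \<notin> S2"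
    proof
      assume "2*t-1 \<in> S2"
      then have "(2*t-1+1)/2 \<in> S"
        unfolding S_def by blast
      with t show False by simp
    qed
    then have "(g2 has_vector_derivative D2 (2*t-1)) (at (2*t-1))"
      using t t2 by (intro D2) auto
    then have "(g2 \<circ> (\<lambda>t. 2*t-1) has_vector_derivative 2 *\<^sub>R D2 (2*t-1)) (at t)"
      by (intro vector_diff_chain_at) (auto intro!: derivative_eq_intros)
    then show ?thesis
      unfolding D_def using t2
      by (auto intro: has_vector_derivative_transform_within_open[where S="{1/2<..}"]
          simp: joinpaths_def)
  qed
  moreover have "D t = 0" if "t \<notin> {0..1}" for t
    using that z1 z2 by (auto simp: D_def)
  ultimately have "path_length (g1 +++ g2) = (\<integral>\<^sup>+t. ennreal (norm (D t)) \<partial>lborel)"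
    by (rule path_length_eqI)
  \<comment> \<open>\<open>D1\<close> and \<open>D2\<close> vanish outside the unit interval, so at
    almost every point at most one summand is nonzero and the halves add up without indicators. An
    affine substitution then cancels the factors 2.\<close>
  also have "\<dots> = (\<integral>\<^sup>+t. ennreal 2 * ennreal (norm (D1 (0 + 2*t))) + ennreal 2 * ennreal (norm (D2 (-1 + 2*t))) \<partial>lborel)"
  proof (rule nn_integral_cong_AE)
    have "AE t in lborel. t \<noteq> (1/2::real)"
      by (rule AE_lborel_singleton)
    then show "AE t in lborel. ennreal (norm (D t))
      = ennreal 2 * ennreal (norm (D1 (0 + 2*t))) + ennreal 2 * ennreal (norm (D2 (-1 + 2*t)))"
    proof eventually_elim
      case (elim t)
      then show ?case
        using z1[of "2*t"] z2[of "2*t-1"]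
        by (auto simp: D_def algebra_simps ennreal_mult' simp flip: ennreal_numeral)
    qed
  qed
  also have "\<dots> = path_length g1 + path_length g2"
    unfolding len1 len2
    nn_integral_real_affine[of "\<lambda>t. ennreal (norm (D1 t))" 2 0, simplified]
    nn_integral_real_affine[of "\<lambda>t. ennreal (norm (D2 t))" 2 "-1", simplified]
    by (simp add: nn_integral_add nn_integral_cmult)
  finally show ?thesis .
qed

lemma surface_path_valid_path: "surface_path M \<gamma> x y \<Longrightarrow> valid_path (immersion M \<circ> \<gamma>)"
  by (simp add: surface_path_def valid_path_def)

lemma intrinsic_dist_le: "surface_path M \<gamma> x y \<Longrightarrow> intrinsic_dist M x y \<le> path_length (immersion M \<circ> \<gamma>)"
  unfolding intrinsic_dist_def surface_path_length_eq by (intro INF_lower2[of \<gamma>]) auto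

text \<open>Chord against arc along every admissible path; if there is none, the infimum is
  infinite. This keeps intrinsic balls about a preimage of the origin inside extrinsic
  balls.\<close>

lemma norm_immersion_diff_le:
  "ennreal (norm (immersion M y - immersion M x)) \<le> intrinsic_dist M x y"
  unfolding intrinsic_dist_def surface_path_length_eq
proof (rule INF_greatest, clarify)
  fix \<gamma> assume "surface_path M \<gamma> x y"
  then show "ennreal (norm (immersion M y - immersion M x)) \<le> path_length (immersion M \<circ> \<gamma>)"
    using norm_diff_le_path_length[OF surface_path_valid_path] by (fastforce simp: surface_path_def)
qed

text \<open>Continuity into the abstract topology comes from pasting the two halves, piecewise C1
  regularity from the concatenated image curves. The equation of images feeds
  \<open>path_length_join\<close>.\<close>

lemma surface_path_join:
  assumes "surface_path M \<gamma> x y" "surface_path M \<delta> y z"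
  shows "\<exists>\<eta>. surface_path M \<eta> x z \<and>
    immersion M \<circ> \<eta> = (immersion M \<circ> \<gamma>) +++ (immersion M \<circ> \<delta>)"
proof -
  define \<eta> where "\<eta> t = (if t \<le> 1/2 then \<gamma> (2*t) else \<delta> (2*t-1))" for t
  have eq: "immersion M \<circ> \<eta> = (immersion M \<circ> \<gamma>) +++ (immersion M \<circ> \<delta>)"
    by (auto simp: fun_eq_iff \<eta>_def joinpaths_def)
  have "valid_path (immersion M \<circ> \<eta>)"
    unfolding eq using assms
    by (intro valid_path_join surface_path_valid_path)
      (auto simp: pathfinish_def pathstart_def surface_path_def)
  moreover have "continuous_map (top_of_set {0..1}) (points M) \<eta>"
    unfolding \<eta>_def
  proof (rule continuous_map_cases_le)
    let ?X = "top_of_set {0..1::real}"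
    have "continuous_map (subtopology ?X {t \<in> topspace ?X. t \<le> 1/2}) (top_of_set {0..1}) (\<lambda>t. 2*t)"
      by (auto simp: subtopology_subtopology continuous_map_in_subtopology intro!: continuous_intros)
    moreover have "continuous_map (top_of_set {0..1}) (points M) \<gamma>"
      using assms(1) by (auto simp: surface_path_def pathin_def)
    ultimately show "continuous_map (subtopology ?X {t \<in> topspace ?X. t \<le> 1/2}) (points M) (\<lambda>t. \<gamma> (2*t))"
      using continuous_map_compose[of _ _ "\<lambda>t. 2*t" _ \<gamma>] by (simp add: o_def)
    have "continuous_map (subtopology ?X {t \<in> topspace ?X. 1/2 \<le> t}) (top_of_set {0..1}) (\<lambda>t. 2*t-1)"
      by (auto simp: subtopology_subtopology continuous_map_in_subtopology intro!: continuous_intros)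
    moreover have "continuous_map (top_of_set {0..1}) (points M) \<delta>"
      using assms(2) by (auto simp: surface_path_def pathin_def)
    ultimately show "continuous_map (subtopology ?X {t \<in> topspace ?X. 1/2 \<le> t}) (points M) (\<lambda>t. \<delta> (2*t-1))"
      using continuous_map_compose[of _ _ "\<lambda>t. 2*t-1" _ \<delta>] by (simp add: o_def)
  next
    fix t :: real assume "t \<in> topspace (top_of_set {0..1})" "t = 1/2"
    then have "2 * t = 1" "2 * t - 1 = 0" by auto
    then show "\<gamma> (2*t) = \<delta> (2*t-1)"
      using assms unfolding surface_path_def by (simp only:)
  qed (auto simp: continuous_intros)
  ultimately show ?thesis
    using assms eq by (intro exI[of _ \<eta>]) (auto simp: surface_path_def valid_path_def pathin_def \<eta>_def)
qed

lemma intrinsic_dist_triangle: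
  "intrinsic_dist M x z \<le> intrinsic_dist M x y + intrinsic_dist M y z"
proof (rule ennreal_le_epsilon)
  fix e :: real
  assume fin: "intrinsic_dist M x y + intrinsic_dist M y z < top" and "e > 0"
  have *: "\<exists>\<gamma>. surface_path M \<gamma> a b \<and> path_length (immersion M \<circ> \<gamma>) \<le> intrinsic_dist M a b + ennreal (e/2)"
    if "intrinsic_dist M a b < top" for a b
  proof -
    \<comment> \<open>Finiteness of the distance makes the inequality strict, so some path is
      shorter than the right-hand side.\<close>
    have "intrinsic_dist M a b < intrinsic_dist M a b + ennreal (e/2)"
      using that \<open>e > 0\<close> by (simp add: ennreal_add_left_cancel_less less_top)
    then obtain \<gamma> where "surface_path M \<gamma> a b"
        "path_length (immersion M \<circ> \<gamma>) < intrinsic_dist M a b + ennreal (e/2)"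
      unfolding intrinsic_dist_def surface_path_length_eq Inf_less_iff by auto
    then show ?thesis
      by (blast intro: less_imp_le)
  qed
  obtain \<gamma> \<delta> where \<gamma>: "surface_path M \<gamma> x y"
      "path_length (immersion M \<circ> \<gamma>) \<le> intrinsic_dist M x y + ennreal (e/2)"
    and \<delta>: "surface_path M \<delta> y z"
      "path_length (immersion M \<circ> \<delta>) \<le> intrinsic_dist M y z + ennreal (e/2)"
    using fin *[of x y] *[of y z] by (auto simp: less_top)
  obtain \<eta> where \<eta>: "surface_path M \<eta> x z"
      "immersion M \<circ> \<eta> = (immersion M \<circ> \<gamma>) +++ (immersion M \<circ> \<delta>)"
    using surface_path_join[OF \<gamma>(1) \<delta>(1)] by blast
  have "intrinsic_dist M x z \<le> path_length (immersion M \<circ> \<gamma>) + path_length (immersion M \<circ> \<delta>)"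
    using intrinsic_dist_le[OF \<eta>(1)] path_length_join \<gamma> \<delta> \<eta>(2) by (metis surface_path_valid_path)
  also have "\<dots> \<le> (intrinsic_dist M x y + ennreal (e/2)) + (intrinsic_dist M y z + ennreal (e/2))"
    using \<gamma> \<delta> by (intro add_mono)
  also have "\<dots> = intrinsic_dist M x y + intrinsic_dist M y z + (ennreal (e/2) + ennreal (e/2))"
    by (simp add: ac_simps)
  also have "ennreal (e/2) + ennreal (e/2) = ennreal e"
    using \<open>e > 0\<close> by (simp flip: ennreal_plus)
  finally show "intrinsic_dist M x z \<le> intrinsic_dist M x y + intrinsic_dist M y z + ennreal e" .
qed

subsection \<open>Sections of a local homeomorphism\<close>

definition locally_injective :: "'a topology \<Rightarrow> ('a \<Rightarrow> 'b) \<Rightarrow> 'a set \<Rightarrow> bool" where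
  "locally_injective X h U \<longleftrightarrow> (\<forall>y\<in>U. \<exists>V. openin X V \<and> y \<in> V \<and> inj_on h V)"

text \<open>Uniqueness of lifts: the set of agreement is closed because \<open>X\<close> is
  Hausdorff, and open because near a common value both maps stay in a set on which \<open>h\<close>
  is injective.\<close>

lemma sections_agree:
  fixes S :: "'b::topological_space set"
  assumes X: "Hausdorff_space X" and inj: "locally_injective X h U"
    and \<sigma>: "continuous_map (top_of_set S) X \<sigma>" and \<tau>: "continuous_map (top_of_set S) X \<tau>"
    and S: "connected S"
    and h: "\<And>z. z \<in> S \<Longrightarrow> h (\<sigma> z) = h (\<tau> z)" and U: "\<And>z. z \<in> S \<Longrightarrow> \<sigma> z \<in> U"
    and z0: "z0 \<in> S" "\<sigma> z0 = \<tau> z0" and z: "z \<in> S"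
  shows "\<sigma> z = \<tau> z"
proof -
  let ?E = "{z \<in> S. \<sigma> z = \<tau> z}"
  have "closedin (top_of_set S) ?E"
    using closedin_continuous_maps_eq[OF X \<sigma> \<tau>] by simp
  moreover have "openin (top_of_set S) ?E"
  proof (subst openin_subopen, intro ballI)
    fix z assume z: "z \<in> ?E"
    then have "\<sigma> z \<in> U"
      using U by blast
    then obtain V where V: "openin X V" "\<sigma> z \<in> V" "inj_on h V"
      using inj unfolding locally_injective_def by blast
    let ?W = "{w \<in> S. \<sigma> w \<in> V} \<inter> {w \<in> S. \<tau> w \<in> V}"
    have "openin (top_of_set S) ?W"
      using openin_continuous_map_preimage[OF \<sigma> V(1)] openin_continuous_map_preimage[OF \<tau> V(1)]
      by (intro openin_Int) auto
    moreover have "z \<in> ?W" "?W \<subseteq> ?E"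
      using V z h by (auto dest: inj_onD)
    ultimately show "\<exists>T. openin (top_of_set S) T \<and> z \<in> T \<and> T \<subseteq> ?E"
      by blast
  qed
  ultimately have "?E = {} \<or> ?E = S"
    using S connected_clopen by blast
  then show ?thesis
    using z0 z by blast
qed

definition section_on :: "'a topology \<Rightarrow> ('a \<Rightarrow> 'b::real_normed_vector) \<Rightarrow> 'a set \<Rightarrow> 'b set \<Rightarrow> ('b \<Rightarrow> 'a) \<Rightarrow> bool" where
  "section_on X h U B \<tau> \<longleftrightarrow>
     continuous_map (top_of_set B) X \<tau> \<and> \<tau> ` B \<subseteq> U \<and> (\<forall>w\<in>B. h (\<tau> w) = w)"

lemma section_on_subset: "section_on X h U B \<tau> \<Longrightarrow> C \<subseteq> B \<Longrightarrow> section_on X h U C \<tau>"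
  unfolding section_on_def by (auto dest: continuous_map_from_subtopology_mono)

lemma sections_on_agree:
  assumes "Hausdorff_space X" "locally_injective X h U"
    and "section_on X h U S \<sigma>" "section_on X h U S \<tau>"
    and "connected S" "z0 \<in> S" "\<sigma> z0 = \<tau> z0" "z \<in> S"
  shows "\<sigma> z = \<tau> z"
proof (rule sections_agree[OF assms(1,2)])
  show "connected S" "z0 \<in> S" "\<sigma> z0 = \<tau> z0" "z \<in> S"
    by fact+
qed (use assms(3,4) in \<open>auto simp: section_on_def\<close>)

text \<open>At this level \<open>d\<close> is an arbitrary function; a triangle inequality from the
  base point enters only in \<open>radial_section\<close>.\<close>

definition lipschitz_section ::
    "'a topology \<Rightarrow> ('a \<Rightarrow> 'b::real_normed_vector) \<Rightarrow> ('a \<Rightarrow> 'a \<Rightarrow> ennreal) \<Rightarrow> real \<Rightarrow> 'a set \<Rightarrow> 'b set \<Rightarrow> ('b \<Rightarrow> 'a) \<Rightarrow> bool" where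
  "lipschitz_section X h d C U B \<tau> \<longleftrightarrow> section_on X h U B \<tau> \<and>
     (\<forall>w\<in>B. \<forall>w'\<in>B. d (\<tau> w) (\<tau> w') \<le> ennreal (C * norm (w - w')))"

text \<open>The last clause makes \<open>\<tau>\<close> a local inverse and not merely a section: it
  passes through every point of \<open>V\<close>. Hence \<open>h\<close> is injective on
  \<open>V\<close>, and one section serves all points of \<open>V\<close> when a compact set is
  covered.\<close>

definition locally_sectioned ::
    "'a topology \<Rightarrow> ('a \<Rightarrow> 'b::real_normed_vector) \<Rightarrow> ('a \<Rightarrow> 'a \<Rightarrow> ennreal) \<Rightarrow> real \<Rightarrow> 'a set \<Rightarrow> bool" where
  "locally_sectioned X h d C U \<longleftrightarrow>
     (\<forall>y\<in>U. \<exists>\<epsilon>>0. \<exists>V \<tau>. openin X V \<and> y \<in> V \<and> lipschitz_section X h d C U (ball (h y) \<epsilon>) \<tau> \<and>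
        (\<forall>y'\<in>V. h y' \<in> ball (h y) \<epsilon> \<and> \<tau> (h y') = y'))"

lemma locally_sectioned_imp_locally_injective:
  "locally_sectioned X h d C U \<Longrightarrow> locally_injective X h U"
  unfolding locally_sectioned_def locally_injective_def inj_on_def by metis

text \<open>A Lebesgue number argument. Halving the radii leaves room to recentre the ball at any
  point of the same member of a finite cover.\<close>

lemma uniform_sections:
  assumes K: "compactin X K" "K \<subseteq> U" and cont: "continuous_map X euclidean h"
    and ls: "locally_sectioned X h d C U"
  obtains \<epsilon> \<sigma> where "\<epsilon> > 0"
    "\<forall>y\<in>K. lipschitz_section X h d C U (ball (h y) \<epsilon>) (\<sigma> y) \<and> \<sigma> y (h y) = y"
proof -
  obtain e V \<tau> where e: "\<And>y. y \<in> U \<Longrightarrow> e y > 0"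
    and V: "\<And>y. y \<in> U \<Longrightarrow> openin X (V y) \<and> y \<in> V y"
    and \<tau>: "\<And>y. y \<in> U \<Longrightarrow> lipschitz_section X h d C U (ball (h y) (e y)) (\<tau> y)"
    and \<tau>V: "\<And>y y'. y \<in> U \<Longrightarrow> y' \<in> V y \<Longrightarrow> \<tau> y (h y') = y'"
    using ls unfolding locally_sectioned_def by metis
  define W where "W y = V y \<inter> {x \<in> topspace X. h x \<in> ball (h y) (e y / 2)}" for y
  have W: "openin X (W y)" "y \<in> W y" if "y \<in> U" for y
    using V[OF that] e[OF that] openin_continuous_map_preimage[OF cont, of "ball (h y) (e y / 2)"] openin_subset
    by (auto simp: W_def intro!: openin_Int)
  have "K \<subseteq> \<Union>(W ` K)" "\<And>V. V \<in> W ` K \<Longrightarrow> openin X V"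
    using K(2) W by auto
  then obtain \<F> where \<F>: "finite \<F>" "\<F> \<subseteq> W ` K" "K \<subseteq> \<Union>\<F>"
    using compactinD[OF K(1), of "W ` K"] by auto
  obtain T where T: "finite T" "T \<subseteq> K" "K \<subseteq> \<Union>(W ` T)"
    using finite_subset_image[OF \<F>(1,2)] \<F>(3) by auto
  \<comment> \<open>The extra 1 keeps the minimum meaningful when \<open>T\<close> is empty.\<close>
  define \<epsilon> where "\<epsilon> = Min (insert 1 ((\<lambda>y. e y / 2) ` T))"
  have "\<epsilon> > 0"
    unfolding \<epsilon>_def using T K e by (subst Min_gr_iff) auto
  moreover have "\<exists>\<sigma>. lipschitz_section X h d C U (ball (h y) \<epsilon>) \<sigma> \<and> \<sigma> (h y) = y" if "y \<in> K" for y
  proof -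
    obtain t where t: "t \<in> T" "y \<in> W t"
      using T(3) \<open>y \<in> K\<close> by blast
    have "t \<in> U"
      using t T K by auto
    have "\<epsilon> \<le> e t / 2"
      unfolding \<epsilon>_def using t T by (intro Min_le) auto
    have "ball (h y) \<epsilon> \<subseteq> ball (h t) (e t)"
    proof
      fix w assume "w \<in> ball (h y) \<epsilon>"
      moreover have "dist (h t) (h y) < e t / 2"
        using t(2) by (simp add: W_def)
      ultimately show "w \<in> ball (h t) (e t)"
        using \<open>\<epsilon> \<le> e t / 2\<close> dist_triangle[of "h t" w "h y"] by simp
    qed
    moreover have "\<tau> t (h y) = y"
      using \<tau>V[OF \<open>t \<in> U\<close>] t(2) by (auto simp: W_def)
    ultimately show ?thesis
      using \<tau>[OF \<open>t \<in> U\<close>] unfolding lipschitz_section_def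
      by (intro exI[of _ "\<tau> t"]) (auto intro: section_on_subset)
  qed
  ultimately show ?thesis
    using that by metis
qed

text \<open>Points near \<open>s z\<close> have local sections that agree on overlaps, because two sections which agree
  at one point of a connected set agree on it; this makes the choice \<open>\<sigma>\<close> irrelevant for continuity.\<close>

lemma extend_section:
  fixes h :: "'a \<Rightarrow> 'b::real_normed_vector"
  assumes X: "Hausdorff_space X" and inj: "locally_injective X h U" and K: "K \<subseteq> U"
    and \<sigma>: "\<And>y. y \<in> K \<Longrightarrow> section_on X h U (ball (h y) \<epsilon>) (\<sigma> y) \<and> \<sigma> y (h y) = y"
    and s: "section_on X h K (ball 0 r) s" and r: "0 < r" "r \<le> r'" "r' - r < \<epsilon>"
  shows "section_on X h U (ball 0 r') (\<lambda>w. \<sigma> (s ((r / r') *\<^sub>R w)) w)"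
proof -
  \<comment> \<open>Shrinking by \<open>c\<close> maps the large ball into the small one and moves
    each point by less than \<open>\<epsilon>\<close>, so \<open>w\<close> lies in the domain of the
    local section through \<open>s (c *\<^sub>R w)\<close>.\<close>
  define c where "c = r / r'"
  have "0 < \<epsilon>"
    using r by auto
  have c: "0 < c" "c \<le> 1" "c * r' = r"
    using r by (auto simp: c_def)
  have cw: "c *\<^sub>R w \<in> ball 0 r" "dist (c *\<^sub>R w) w < \<epsilon>" "s (c *\<^sub>R w) \<in> K" "h (s (c *\<^sub>R w)) = c *\<^sub>R w"
    if "w \<in> ball 0 r'" for w
  proof -
    show *: "c *\<^sub>R w \<in> ball 0 r"
      using that c mult_strict_left_mono[of "norm w" r' c] by simp
    have "dist (c *\<^sub>R w) w = norm ((1 - c) *\<^sub>R w)"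
      by (simp add: dist_norm norm_minus_commute algebra_simps)
    also have "\<dots> = (1 - c) * norm w"
      using c by simp
    also have "\<dots> \<le> (1 - c) * r'"
      using c that by (intro mult_left_mono) auto
    also have "\<dots> < \<epsilon>"
      using c r by (simp add: algebra_simps)
    finally show "dist (c *\<^sub>R w) w < \<epsilon>" .
    show "s (c *\<^sub>R w) \<in> K" "h (s (c *\<^sub>R w)) = c *\<^sub>R w"
      using s * by (auto simp: section_on_def)
  qed
  let ?s = "\<lambda>w. \<sigma> (s (c *\<^sub>R w)) w"
  have sec: "section_on X h U (ball (c *\<^sub>R w) \<epsilon>) (\<sigma> (s (c *\<^sub>R w)))" "\<sigma> (s (c *\<^sub>R w)) (c *\<^sub>R w) = s (c *\<^sub>R w)"
    if "w \<in> ball 0 r'" for w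
    using \<sigma>[OF cw(3)[OF that]] cw(4)[OF that] by auto
  have "\<forall>w0\<in>ball 0 r'. \<exists>T. openin (top_of_set (ball 0 r')) T \<and> w0 \<in> T \<and>
      continuous_map (subtopology (top_of_set (ball 0 r')) T) X ?s"
  proof
    fix w0 :: 'b assume w0: "w0 \<in> ball 0 r'"
    let ?\<tau> = "\<sigma> (s (c *\<^sub>R w0))" and ?B = "ball (c *\<^sub>R w0) \<epsilon>"
    \<comment> \<open>On \<open>T\<close> both \<open>w\<close> and its shrunken point lie in the
      domain of the single section \<open>?\<tau>\<close>, with which the varying sections can then
      be compared.\<close>
    define T where "T = ball 0 r' \<inter> (?B \<inter> (\<lambda>w. c *\<^sub>R w) -` ?B)"
    have "open T"
      unfolding T_def by (intro open_Int open_ball open_vimage continuous_intros)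
    then have "openin (top_of_set (ball 0 r')) T"
      by (subst openin_open_eq) (auto simp: T_def)
    moreover have "w0 \<in> T"
      using w0 cw(2)[OF w0] \<open>0 < \<epsilon>\<close> by (auto simp: T_def)
    moreover have "continuous_map (subtopology (top_of_set (ball 0 r')) T) X ?s"
    proof (rule continuous_map_eq[of _ _ ?\<tau>])
      have "continuous_map (top_of_set ?B) X ?\<tau>"
        using sec(1)[OF w0] by (auto simp: section_on_def)
      then show "continuous_map (subtopology (top_of_set (ball 0 r')) T) X ?\<tau>"
        by (auto simp: subtopology_subtopology T_def intro: continuous_map_from_subtopology_mono)
      fix w assume "w \<in> topspace (subtopology (top_of_set (ball 0 r')) T)"
      then have w: "w \<in> ball 0 r'" "w \<in> ?B" "c *\<^sub>R w \<in> ?B"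
        by (auto simp: T_def)
      \<comment> \<open>Agreement passes from \<open>c *\<^sub>R w0\<close> to
        \<open>c *\<^sub>R w\<close> by comparing \<open>?\<tau>\<close> with \<open>s\<close>, then
        from \<open>c *\<^sub>R w\<close> to \<open>w\<close> by comparing two local sections. Both
        domains are intersections of two balls, hence connected.\<close>
      let ?C = "ball 0 r \<inter> ?B"
      have "?\<tau> (c *\<^sub>R w) = s (c *\<^sub>R w)"
      proof (rule sections_on_agree[OF X inj, where \<sigma>="?\<tau>" and \<tau>=s])
        show "section_on X h U ?C ?\<tau>"
          by (rule section_on_subset[OF sec(1)[OF w0]]) auto
        show "section_on X h U ?C s"
          using section_on_subset[OF s, of ?C] K by (auto simp: section_on_def)
        show "connected ?C"
          by (intro convex_connected convex_Int convex_ball)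
        show "c *\<^sub>R w0 \<in> ?C" "c *\<^sub>R w \<in> ?C"
          using cw(1)[OF w0] cw(1)[OF w(1)] w cw(2)[OF w0] \<open>0 < \<epsilon>\<close> by auto
      qed (use sec(2)[OF w0] in auto)
      let ?D = "?B \<inter> ball (c *\<^sub>R w) \<epsilon>"
      show "?\<tau> w = ?s w"
      proof (rule sections_on_agree[OF X inj, where \<sigma>="?\<tau>" and \<tau>="\<sigma> (s (c *\<^sub>R w))"])
        show "section_on X h U ?D ?\<tau>"
          by (rule section_on_subset[OF sec(1)[OF w0]]) auto
        show "section_on X h U ?D (\<sigma> (s (c *\<^sub>R w)))"
          by (rule section_on_subset[OF sec(1)[OF w(1)]]) auto
        show "connected ?D"
          by (intro convex_connected convex_Int convex_ball)
        show "c *\<^sub>R w \<in> ?D" "w \<in> ?D"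
          using w cw(2)[OF w(1)] \<open>0 < \<epsilon>\<close> by auto
        show "?\<tau> (c *\<^sub>R w) = \<sigma> (s (c *\<^sub>R w)) (c *\<^sub>R w)"
          using \<open>?\<tau> (c *\<^sub>R w) = s (c *\<^sub>R w)\<close> sec(2)[OF w(1)] by simp
      qed
    qed
    ultimately show "\<exists>T. openin (top_of_set (ball 0 r')) T \<and> w0 \<in> T \<and>
        continuous_map (subtopology (top_of_set (ball 0 r')) T) X ?s"
      by blast
  qed
  then obtain T where "\<And>w0. w0 \<in> ball 0 r' \<Longrightarrow> openin (top_of_set (ball 0 r')) (T w0) \<and> w0 \<in> T w0 \<and>
      continuous_map (subtopology (top_of_set (ball 0 r')) (T w0)) X ?s"
    by metis
  then have "continuous_map (top_of_set (ball 0 r')) X ?s"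
    by (intro pasting_lemma[of "ball 0 r'" "top_of_set (ball 0 r')" T X "\<lambda>_. ?s"]) auto
  then show ?thesis
    using sec(1) cw(2) unfolding section_on_def c_def[symmetric]
    by (auto simp: image_subset_iff)
qed

text \<open>Compactness gives one \<open>\<epsilon>\<close> for all points of the closed ball, so
  the radius can grow by fixed steps. The bound of \<open>d x0 (s w)\<close> by
  \<open>C * norm w\<close> is part of the induction: it confines the section to that closed ball up
  to radius \<open>a / C\<close>.\<close>

lemma radial_section:
  fixes h :: "'a \<Rightarrow> 'b::real_normed_vector"
  assumes X: "Hausdorff_space X" and cont: "continuous_map X euclidean h"
    and x0: "x0 \<in> U" "h x0 = 0" and a: "a > 0" and C: "C > 0"
    and K: "compactin X {y \<in> topspace X. d x0 y \<le> ennreal a}" "{y \<in> topspace X. d x0 y \<le> ennreal a} \<subseteq> U"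
    and ls: "locally_sectioned X h d C U"
    and triangle: "\<And>y z. d x0 z \<le> d x0 y + d y z"
  obtains s where "section_on X h {y \<in> topspace X. d x0 y \<le> ennreal a} (ball 0 (a / C)) s" "s 0 = x0"
proof -
  let ?K = "{y \<in> topspace X. d x0 y \<le> ennreal a}"
  obtain \<epsilon> \<sigma> where \<epsilon>: "\<epsilon> > 0"
    and \<sigma>': "\<forall>y\<in>?K. lipschitz_section X h d C U (ball (h y) \<epsilon>) (\<sigma> y) \<and> \<sigma> y (h y) = y"
    using uniform_sections[OF K cont ls] .
  have lip: "lipschitz_section X h d C U (ball (h y) \<epsilon>) (\<sigma> y)" and \<sigma>: "\<sigma> y (h y) = y" if "y \<in> ?K" for y
    using \<sigma>' that by blast+
  have sec: "section_on X h U (ball (h y) \<epsilon>) (\<sigma> y)" if "y \<in> ?K" for y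
    using lip[OF that] by (simp add: lipschitz_section_def)
  have sec_K: "section_on X h ?K (ball 0 r) s"
    if "section_on X h U (ball 0 r) s" "\<And>w. w \<in> ball 0 r \<Longrightarrow> d x0 (s w) \<le> ennreal (C * norm w)" "r \<le> a / C"
    for r s
  proof -
    have "s w \<in> ?K" if w: "w \<in> ball 0 r" for w
    proof -
      have "C * norm w \<le> a"
        using w \<open>r \<le> a / C\<close> C pos_le_divide_eq[of C "norm w" a] by (simp add: mult.commute)
      then have "d x0 (s w) \<le> ennreal a"
        using \<open>\<And>w. w \<in> ball 0 r \<Longrightarrow> d x0 (s w) \<le> ennreal (C * norm w)\<close>[OF w]
        by (meson ennreal_leI order_trans)
      moreover have "s w \<in> topspace X"
        using continuous_map_image_subset_topspace[of "top_of_set (ball 0 r)" X s]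
          \<open>section_on X h U (ball 0 r) s\<close> w
        by (auto simp: section_on_def)
      ultimately show ?thesis
        by simp
    qed
    then show ?thesis
      using that(1) by (auto simp: section_on_def)
  qed
  \<comment> \<open>The bound is linear in \<open>norm w\<close>: a uniform bound by
    \<open>a\<close> would get worse with every extension.\<close>
  define P where "P r \<longleftrightarrow> (\<exists>s. section_on X h ?K (ball 0 r) s \<and> s 0 = x0 \<and>
      (\<forall>w\<in>ball 0 r. d x0 (s w) \<le> ennreal (C * norm w)))" for r
  obtain e0 V \<tau> where e0: "e0 > 0" "x0 \<in> V" "lipschitz_section X h d C U (ball (h x0) e0) \<tau>"
      "\<forall>y'\<in>V. h y' \<in> ball (h x0) e0 \<and> \<tau> (h y') = y'"
    using ls x0(1) unfolding locally_sectioned_def by metis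
  define r0 where "r0 = min e0 (a / C)"
  have r0_le: "r0 \<le> a / C"
    by (simp add: r0_def)
  have r0: "r0 > 0"
    using e0 a C by (simp add: r0_def)
  have "P r0"
  proof -
    have \<tau>0: "\<tau> 0 = x0"
      using e0 x0 by auto
    have dist: "d x0 (\<tau> w) \<le> ennreal (C * norm w)" if "w \<in> ball 0 r0" for w
    proof -
      have "0 \<in> ball (h x0) e0" "w \<in> ball (h x0) e0"
        using that x0 e0 by (auto simp: r0_def)
      then have "d (\<tau> 0) (\<tau> w) \<le> ennreal (C * norm (0 - w))"
        using e0(3) unfolding lipschitz_section_def by blast
      then show ?thesis
        by (simp add: \<tau>0)
    qed
    moreover have "section_on X h U (ball 0 r0) \<tau>"
      using e0(3) x0 by (auto simp: lipschitz_section_def r0_def intro: section_on_subset)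
    ultimately show ?thesis
      unfolding P_def using sec_K[of r0 \<tau>] \<tau>0 by (auto simp: r0_def)
  qed
  have step: "P r'" if "P r" "0 < r" "r \<le> r'" "r' - r < \<epsilon>" "r' \<le> a / C" for r r'
  proof -
    obtain s where s: "section_on X h ?K (ball 0 r) s" "s 0 = x0"
        "\<And>w. w \<in> ball 0 r \<Longrightarrow> d x0 (s w) \<le> ennreal (C * norm w)"
      using \<open>P r\<close> unfolding P_def by blast
    define c where "c = r / r'"
    have c: "0 < c" "c \<le> 1" "c * r' = r"
      using that by (auto simp: c_def)
    let ?s = "\<lambda>w. \<sigma> (s (c *\<^sub>R w)) w"
    have "section_on X h U (ball 0 r') ?s"
      unfolding c_def using that
      by (intro extend_section[OF X locally_sectioned_imp_locally_injective[OF ls] K(2) _ s(1)]) (auto simp: sec \<sigma>)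
    moreover have "?s 0 = x0"
    proof -
      have "0 \<in> ball (0::'b) r"
        using \<open>0 < r\<close> by simp
      then have "x0 \<in> ?K"
        using s(1) unfolding section_on_def s(2)[symmetric] by blast
      then show ?thesis
        using \<sigma>[of x0] x0 s by simp
    qed
    moreover have "d x0 (?s w) \<le> ennreal (C * norm w)" if w: "w \<in> ball 0 r'" for w
    proof -
      have cw: "c *\<^sub>R w \<in> ball 0 r"
        using w c mult_strict_left_mono[of "norm w" r' c] by simp
      then have K: "s (c *\<^sub>R w) \<in> ?K" and h: "h (s (c *\<^sub>R w)) = c *\<^sub>R w"
        using s(1) unfolding section_on_def by blast+
      have "norm (c *\<^sub>R w - w) = norm ((1 - c) *\<^sub>R w)"
        by (simp add: norm_minus_commute algebra_simps)
      then have nrm: "norm (c *\<^sub>R w - w) = (1 - c) * norm w"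
        using c by simp
      also have "\<dots> \<le> (1 - c) * r'"
        using c w by (intro mult_left_mono) auto
      also have "\<dots> < \<epsilon>"
        using c \<open>r' - r < \<epsilon>\<close> by (simp add: algebra_simps)
      finally have "c *\<^sub>R w \<in> ball (h (s (c *\<^sub>R w))) \<epsilon>" "w \<in> ball (h (s (c *\<^sub>R w))) \<epsilon>"
        using \<epsilon> unfolding h by (auto simp: dist_norm)
      then have "d (\<sigma> (s (c *\<^sub>R w)) (c *\<^sub>R w)) (?s w) \<le> ennreal (C * norm (c *\<^sub>R w - w))"
        using lip[OF K] unfolding lipschitz_section_def by blast
      then have "d (s (c *\<^sub>R w)) (?s w) \<le> ennreal (C * ((1 - c) * norm w))"
        using \<sigma>[OF K] unfolding h nrm by simp
      then have "d x0 (?s w) \<le> ennreal (C * norm (c *\<^sub>R w)) + ennreal (C * ((1 - c) * norm w))"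
        using triangle[where y="s (c *\<^sub>R w)" and z="?s w"] s(3)[OF cw] add_mono order_trans by blast
      also have "\<dots> = ennreal (C * norm (c *\<^sub>R w) + C * ((1 - c) * norm w))"
        using c C by (intro ennreal_plus[symmetric]) auto
      \<comment> \<open>\<open>c *\<^sub>R w\<close> lies on the radius through \<open>w\<close>, so
        the two Lipschitz bounds add up without loss, however many extensions are made.\<close>
      also have "C * norm (c *\<^sub>R w) + C * ((1 - c) * norm w) = C * norm w"
        using c by (simp add: algebra_simps)
      finally show ?thesis .
    qed
    ultimately show ?thesis
      unfolding P_def using sec_K[of r' ?s] \<open>r' \<le> a / C\<close> by blast
  qed
  \<comment> \<open>One extension must increase the radius by strictly less than
    \<open>\<epsilon>\<close>.\<close>
  define e where "e = \<epsilon> / 2"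
  have e: "0 < e" "e < \<epsilon>"
    using \<epsilon> by (auto simp: e_def)
  have "P (min (a / C) (r0 + real n * e))" for n
  proof (induction n)
    case 0
    then show ?case
      using \<open>P r0\<close> by (simp add: min_absorb2 r0_le)
  next
    case (Suc n)
    have "0 < r0 + real n * e"
      using r0 e by (intro add_pos_nonneg) auto
    moreover have "real (Suc n) * e = real n * e + e"
      by (simp add: distrib_right)
    moreover have "0 < a / C"
      using a C by simp
    ultimately show ?case
      using e by (intro step[OF Suc]) linarith+
  qed
  moreover obtain n where "a / C < real n * e"
    using reals_Archimedean3[of e] e by auto
  then have "min (a / C) (r0 + real n * e) = a / C"
    using r0 by simp
  ultimately have "P (a / C)"
    by metis
  then show ?thesis
    using that unfolding P_def by blast
qed

text \<open>The part of \<open>S\<close> lying on the section is the fixed point set of the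
  continuous map sending \<open>y\<close> to \<open>s (h y)\<close>, which makes closedness an
  equalizer argument. Elsewhere \<open>h\<close> may identify points, but \<open>S\<close> cannot
  leave the sheet of \<open>s\<close>.\<close>

lemma connected_subset_section_image:
  assumes X: "Hausdorff_space X" and cont: "continuous_map X euclidean h"
    and inj: "locally_injective X h U" and s: "section_on X h U B s"
    and S: "connectedin X S" "h ` S \<subseteq> B" and z0: "z0 \<in> B" "s z0 \<in> S"
  shows "S \<subseteq> s ` B"
proof -
  let ?X = "subtopology X S" and ?E = "{y \<in> S. s (h y) = y}"
  have [simp]: "topspace ?X = S"
    using S connectedin_subset_topspace by (metis inf.absorb2 topspace_subtopology)
  have "continuous_map ?X (top_of_set B) h"
    using cont S by (auto simp: continuous_map_in_subtopology intro: continuous_map_from_subtopology)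
  then have sh: "continuous_map ?X X (\<lambda>y. s (h y))"
    using s continuous_map_compose[of _ _ h X s] by (simp add: section_on_def o_def)
  have "closedin ?X ?E"
    using closedin_continuous_maps_eq[OF X sh, of "\<lambda>y. y"] unfolding \<open>topspace ?X = S\<close> by simp
  moreover have "openin ?X ?E"
  proof (subst openin_subopen, intro ballI)
    fix y assume y: "y \<in> ?E"
    then have "h y \<in> B"
      using S by blast
    then have "s (h y) \<in> U"
      using s unfolding section_on_def by blast
    then have "y \<in> U"
      using y by simp
    then obtain V where V: "openin X V" "y \<in> V" "inj_on h V"
      using inj unfolding locally_injective_def by blast
    let ?W = "{y \<in> S. s (h y) \<in> V} \<inter> (S \<inter> V)"
    have "openin ?X ?W"
      using openin_continuous_map_preimage[OF sh V(1)] openin_subtopology_Int2[OF V(1), of S]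
      unfolding \<open>topspace ?X = S\<close> by (rule openin_Int)
    moreover have "?W \<subseteq> ?E"
    proof
      fix y' assume y': "y' \<in> ?W"
      then have "h (s (h y')) = h y'"
        using s S by (auto simp: section_on_def)
      then show "y' \<in> ?E"
        using y' V(3) by (auto dest: inj_onD)
    qed
    ultimately show "\<exists>T. openin ?X T \<and> y \<in> T \<and> T \<subseteq> ?E"
      using y V(2) by (intro exI[of _ ?W]) auto
  qed
  moreover have "connected_space ?X"
    using S(1) by (simp add: connectedin_def)
  ultimately have "?E = {} \<or> ?E = S"
    unfolding connected_space_clopen_in \<open>topspace ?X = S\<close> by blast
  moreover have "s z0 \<in> ?E"
    using z0 s by (auto simp: section_on_def)
  ultimately have "?E = S"
    by blast
  then show ?thesis
    using S(2) by (force simp: image_iff)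
qed

subsection \<open>Charts at interior points\<close>

text \<open>Based on \<open>B w - B w0 = B w o\<^sub>L (A w0 - A w) o\<^sub>L B w0\<close>. It makes
  the derivative of a local inverse continuous, so that lifted segments are C1 curves.\<close>

lemma continuous_on_blinfun_inverse:
  fixes A :: "'a::metric_space \<Rightarrow> 'b::real_normed_vector \<Rightarrow>\<^sub>L 'c::real_normed_vector"
  assumes A: "continuous_on S A"
    and AB: "\<And>w. w \<in> S \<Longrightarrow> A w o\<^sub>L B w = id_blinfun" and BA: "\<And>w. w \<in> S \<Longrightarrow> B w o\<^sub>L A w = id_blinfun"
  shows "continuous_on S B"
  unfolding continuous_on_def
proof
  fix w0 assume w0: "w0 \<in> S"
  let ?F = "at w0 within S" and ?e = "\<lambda>w. norm (A w0 - A w) * norm (B w0)"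
  have "((\<lambda>w. A w) \<longlongrightarrow> A w0) ?F"
    using A w0 by (simp add: continuous_on_def)
  then have "((\<lambda>w. norm (A w0 - A w)) \<longlongrightarrow> norm (A w0 - A w0)) ?F"
    by (intro tendsto_intros)
  then have e: "(?e \<longlongrightarrow> 0) ?F"
    using tendsto_mult_left_zero[of "\<lambda>w. norm (A w0 - A w)" ?F "norm (B w0)"] by simp
  have S: "\<forall>\<^sub>F w in ?F. w \<in> S"
    by (simp add: eventually_at_filter)
  have diff: "norm (B w - B w0) \<le> norm (B w) * ?e w" if "w \<in> S" for w
  proof -
    have "B w - B w0 = (B w o\<^sub>L (A w0 - A w)) o\<^sub>L B w0"
    proof (rule blinfun_eqI)
      fix u
      have "A w0 (B w0 u) = u" "B w (A w (B w0 u)) = B w0 u"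
        using arg_cong[OF AB[OF w0], of "\<lambda>T. blinfun_apply T u"]
          arg_cong[OF BA[OF that], of "\<lambda>T. blinfun_apply T (B w0 u)"] by auto
      then show "(B w - B w0) u = ((B w o\<^sub>L (A w0 - A w)) o\<^sub>L B w0) u"
        by (simp add: blinfun.diff_left blinfun.diff_right)
    qed
    also have "norm \<dots> \<le> norm (B w o\<^sub>L (A w0 - A w)) * norm (B w0)"
      by (rule norm_blinfun_compose)
    also have "\<dots> \<le> (norm (B w) * norm (A w0 - A w)) * norm (B w0)"
      by (intro mult_right_mono norm_blinfun_compose) auto
    finally show ?thesis by (simp add: mult.assoc)
  qed
  \<comment> \<open>Below 1/2 the factor lets \<open>norm (B w)\<close> be absorbed: it is at most
    twice \<open>norm (B w0)\<close>, and the estimate of the difference no longer involves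
    \<open>B w\<close>.\<close>
  have small: "\<forall>\<^sub>F w in ?F. ?e w < 1/2"
    using e by (intro order_tendstoD) auto
  have bd: "\<forall>\<^sub>F w in ?F. norm (B w - B w0) \<le> 2 * norm (B w0) * ?e w"
    using small S
  proof eventually_elim
    case (elim w)
    have "norm (B w) \<le> norm (B w0) + norm (B w - B w0)"
      by (metis add.commute diff_add_cancel norm_triangle_ineq)
    also have "norm (B w - B w0) \<le> norm (B w) * (1/2)"
      using diff[OF elim(2)] elim(1) mult_left_mono[of "?e w" "1/2" "norm (B w)"]
      by (meson less_imp_le norm_ge_zero order_trans)
    finally have "norm (B w) \<le> 2 * norm (B w0)"
      by simp
    then have "norm (B w) * ?e w \<le> 2 * norm (B w0) * ?e w"
      by (intro mult_right_mono) auto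
    then show ?case
      using diff[OF elim(2)] by linarith
  qed
  have "((\<lambda>w. 2 * norm (B w0) * ?e w) \<longlongrightarrow> 0) ?F"
    using tendsto_mult_right_zero[OF e] by blast
  then have "((\<lambda>w. B w - B w0) \<longlongrightarrow> 0) ?F"
    using bd by (rule Lim_null_comparison[rotated])
  then show "(B \<longlongrightarrow> B w0) ?F"
    using LIM_zero_cancel by blast
qed

definition C1_with_derivative :: "('a::euclidean_space \<Rightarrow> 'b::euclidean_space) \<Rightarrow> 'a set \<Rightarrow> ('a \<Rightarrow> 'a \<Rightarrow>\<^sub>L 'b) \<Rightarrow> bool" where
  "C1_with_derivative f B f' \<longleftrightarrow> (\<forall>z\<in>B. (f has_derivative blinfun_apply (f' z)) (at z)) \<and> continuous_on B f'"

text \<open>In the interior the local smooth extension agrees with \<open>f\<close> on a whole ball,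
  so its derivatives are those of \<open>f\<close>. In finite dimension, continuity of the
  derivative in each basis direction gives continuity in operator norm.\<close>

lemma smooth_on_imp_C1:
  fixes f :: "'a::euclidean_space \<Rightarrow> 'b::euclidean_space"
  assumes f: "smooth_on S f" and v: "v \<in> interior S"
  obtains \<delta> f' where "\<delta> > 0" "ball v \<delta> \<subseteq> S" "C1_with_derivative f (ball v \<delta>) f'"
proof -
  have "v \<in> S"
    using v interior_subset by blast
  then obtain W h where W: "open W" "v \<in> W" and Ck: "\<forall>k. Ck_on k W h" and eq: "\<forall>y\<in>S \<inter> W. h y = f y"
    using f unfolding smooth_on_def by metis
  have diff: "h differentiable_on W" and cont: "\<And>u. continuous_on W (\<lambda>x. frechet_derivative h (at x) u)"
    using Ck[rule_format, of "Suc 0"] by auto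
  have "open (W \<inter> interior S)" "v \<in> W \<inter> interior S"
    using W v by auto
  then obtain \<delta> where \<delta>: "\<delta> > 0" "ball v \<delta> \<subseteq> W \<inter> interior S"
    using open_contains_ball by blast
  define f' where "f' z = Blinfun (frechet_derivative h (at z))" for z
  have h: "(h has_derivative frechet_derivative h (at z)) (at z)" if "z \<in> W" for z
    using diff W(1) that by (metis at_within_open differentiable_on_def frechet_derivative_works)
  then have f': "blinfun_apply (f' z) = frechet_derivative h (at z)" if "z \<in> W" for z
    unfolding f'_def using that by (intro bounded_linear_Blinfun_apply) (rule has_derivative_bounded_linear)
  have "(f has_derivative blinfun_apply (f' z)) (at z)" if z: "z \<in> ball v \<delta>" for z
  proof (rule has_derivative_transform_within_open)
    show "(h has_derivative blinfun_apply (f' z)) (at z)"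
      using h f' z \<delta> by (metis IntD1 subsetD)
    show "open (ball v \<delta>)" "z \<in> ball v \<delta>"
      using z by auto
    show "h y = f y" if "y \<in> ball v \<delta>" for y
      using eq that \<delta> interior_subset by blast
  qed
  moreover have "continuous_on (ball v \<delta>) f'"
  proof (rule continuous_on_blinfun_componentwise)
    fix i :: 'a
    have "continuous_on (ball v \<delta>) (\<lambda>x. frechet_derivative h (at x) i)"
      using cont \<delta> continuous_on_subset by blast
    then show "continuous_on (ball v \<delta>) (\<lambda>x. f' x i)"
      using f' \<delta> by (subst continuous_on_cong[OF refl, of _ _ "\<lambda>x. frechet_derivative h (at x) i"]) auto
  qed
  ultimately show ?thesis
    using that[OF \<delta>(1)] \<delta>(2) interior_subset[of S] unfolding C1_with_derivative_def by blast
qed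

text \<open>Also covers the edge of the half plane, and so gives continuity of the immersion on all
  of \<open>M\<close>, boundary included.\<close>

lemma smooth_on_imp_continuous_on:
  assumes "smooth_on S f" shows "continuous_on S f"
  unfolding continuous_on_eq_continuous_within
proof
  fix x assume x: "x \<in> S"
  obtain W h where W: "open W" "x \<in> W" and Ck: "\<forall>k. Ck_on k W h" and eq: "\<forall>y\<in>S \<inter> W. h y = f y"
    using assms x unfolding smooth_on_def by metis
  have "isCont h x"
    using Ck[rule_format, of 0] W by (simp add: continuous_on_eq_continuous_at)
  then have "(h \<longlongrightarrow> h x) (at x within S)"
    using isCont_def tendsto_within_subset by blast
  moreover have "\<forall>\<^sub>F y in at x within S. h y = f y"
    unfolding eventually_at_topological using W eq by blast
  ultimately have "(f \<longlongrightarrow> f x) (at x within S)"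
    using eq x W tendsto_cong[of h f "at x within S" "h x"] by simp
  then show "continuous (at x within S) f"
    by (simp add: continuous_within)
qed

abbreviation chart_inv :: "'a chart \<Rightarrow> real^2 \<Rightarrow> 'a" where
  "chart_inv c \<equiv> inv_into (fst c) (snd c)"

lemma in_chart_apply: "in_chart f c z = f (chart_inv c z)"
  by (simp add: in_chart_def)

locale surface =
  fixes M :: "'a surface"
  assumes immersed: "immersed_surface M"
begin

lemma atlas_chart: "c \<in> atlas M \<Longrightarrow> is_chart (points M) c"
  using immersed by (auto simp: immersed_surface_def)

lemma chart_facts:
  assumes c: "c \<in> atlas M"
  shows "openin (points M) (fst c)" "inj_on (snd c) (fst c)"
    and "openin (top_of_set half_plane) (chart_image c)"
    and "continuous_map (subtopology (points M) (fst c)) (top_of_set (chart_image c)) (snd c)"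
    and "continuous_map (top_of_set (chart_image c)) (points M) (chart_inv c)"
proof -
  have hom: "homeomorphic_map (subtopology (points M) (fst c)) (top_of_set (chart_image c)) (snd c)"
    and 1: "openin (points M) (fst c)"
    using atlas_chart[OF c] by (auto simp: is_chart_def)
  then have top: "topspace (subtopology (points M) (fst c)) = fst c"
    by (metis inf.absorb2 openin_subset topspace_subtopology)
  show 2: "inj_on (snd c) (fst c)"
    using homeomorphic_imp_injective_map[OF hom] top by simp
  show "continuous_map (subtopology (points M) (fst c)) (top_of_set (chart_image c)) (snd c)"
    using hom by (rule homeomorphic_imp_continuous_map)
  obtain g where g: "homeomorphic_maps (subtopology (points M) (fst c)) (top_of_set (chart_image c)) (snd c) g"
    using hom by (auto simp: homeomorphic_map_maps)
  then have "continuous_map (top_of_set (chart_image c)) (points M) g"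
    by (auto simp: homeomorphic_maps_def continuous_map_in_subtopology)
  \<comment> \<open>The homeomorphism provides some inverse \<open>g\<close>; on the chart image it
    coincides with the \<open>inv_into\<close> used by \<open>in_chart\<close>.\<close>
  moreover have "g z = chart_inv c z" if z: "z \<in> chart_image c" for z
  proof -
    have "g z \<in> fst c" "snd c (g z) = z"
      using g z top continuous_map_image_subset_topspace[of "top_of_set (chart_image c)" "subtopology (points M) (fst c)" g]
      by (auto simp: homeomorphic_maps_def)
    then show ?thesis
      using 2 by (metis inv_into_f_f)
  qed
  ultimately show "continuous_map (top_of_set (chart_image c)) (points M) (chart_inv c)"
    by (rule continuous_map_eq) simp
qed (use atlas_chart[OF c] in \<open>auto simp: is_chart_def\<close>)

lemma chart_inv_chart [simp]: "c \<in> atlas M \<Longrightarrow> x \<in> fst c \<Longrightarrow> chart_inv c (snd c x) = x"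
  by (simp add: chart_facts)

lemma chart_chart_inv [simp]: "z \<in> chart_image c \<Longrightarrow> snd c (chart_inv c z) = z"
  by (simp add: chart_image_def f_inv_into_f)

lemma chart_inv_in: "z \<in> chart_image c \<Longrightarrow> chart_inv c z \<in> fst c"
  by (simp add: chart_image_def inv_into_into)

lemma openin_chart_inv_image:
  assumes c: "c \<in> atlas M" and V: "open V" "V \<subseteq> chart_image c"
  shows "openin (points M) (chart_inv c ` V)"
proof -
  have top: "topspace (subtopology (points M) (fst c)) = fst c"
    by (metis c chart_facts(1) inf.absorb2 openin_subset topspace_subtopology)
  have "openin (top_of_set (chart_image c)) V"
    unfolding openin_open using V by blast
  then have "openin (subtopology (points M) (fst c)) {x \<in> fst c. snd c x \<in> V}"
    using openin_continuous_map_preimage[OF chart_facts(4)[OF c]] top by fastforce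
  then have "openin (points M) {x \<in> fst c. snd c x \<in> V}"
    using chart_facts(1)[OF c] openin_open_subtopology by blast
  moreover have "{x \<in> fst c. snd c x \<in> V} = chart_inv c ` V"
  proof (intro equalityI subsetI)
    fix x assume "x \<in> {x \<in> fst c. snd c x \<in> V}"
    then show "x \<in> chart_inv c ` V"
      using chart_inv_chart[OF c, of x] by force
  next
    fix x assume "x \<in> chart_inv c ` V"
    then obtain z where z: "x = chart_inv c z" "z \<in> V"
      by blast
    then have "z \<in> chart_image c"
      using V by blast
    then show "x \<in> {x \<in> fst c. snd c x \<in> V}"
      using z chart_inv_in chart_chart_inv by simp
  qed
  ultimately show ?thesis by simp
qed

text \<open>\<open>surface_boundary\<close> asks for some chart with second coordinate 0, so a point
  outside it has positive second coordinate in whichever chart contains it.\<close>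

lemma chart_in_interior:
  assumes c: "c \<in> atlas M" and x: "x \<in> fst c" "x \<notin> surface_boundary M"
  shows "snd c x \<in> interior (chart_image c)"
proof -
  obtain T where T: "open T" "chart_image c = half_plane \<inter> T"
    using chart_facts(3)[OF c] by (auto simp: openin_open)
  have mem: "snd c x \<in> chart_image c"
    using x by (simp add: chart_image_def)
  have "x \<in> topspace (points M)"
    using c x chart_facts(1) openin_subset by blast
  then have "snd c x $ 2 \<noteq> 0"
    using x c by (auto simp: surface_boundary_def)
  then have "snd c x \<in> T \<inter> {v. 0 < v $ 2}"
    using mem unfolding T(2) half_plane_def by simp
  moreover have "open (T \<inter> {v :: real^2. 0 < v $ 2})"
    by (rule open_Int[OF T(1) open_halfspace_component_gt_cart])
  moreover have "T \<inter> {v. 0 < v $ 2} \<subseteq> chart_image c"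
    unfolding T(2) half_plane_def by auto
  ultimately show ?thesis
    using interiorI by blast
qed

lemma immersion_smooth: "c \<in> atlas M \<Longrightarrow> smooth_on (chart_image c) (in_chart (immersion M) c)"
  using immersed by (auto simp: immersed_surface_def)

lemma obtain_chart:
  assumes "x \<in> topspace (points M)"
  obtains c where "c \<in> atlas M" "x \<in> fst c"
proof -
  have "x \<in> (\<Union>c\<in>atlas M. fst c)"
    using assms immersed by (simp add: immersed_surface_def)
  then show ?thesis
    using that by blast
qed

lemma chart_C1:
  assumes c: "c \<in> atlas M" and x: "x \<in> fst c" "x \<notin> surface_boundary M"
  obtains \<delta> f' where "\<delta> > 0" "ball (snd c x) \<delta> \<subseteq> chart_image c"
    "C1_with_derivative (in_chart (immersion M) c) (ball (snd c x) \<delta>) f'"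
  using smooth_on_imp_C1[OF immersion_smooth[OF c] chart_in_interior[OF assms]] by metis

lemma continuous_immersion: "continuous_map (points M) euclidean (immersion M)"
proof (rule pasting_lemma[where I="atlas M" and T=fst and f="\<lambda>_. immersion M"])
  fix c assume c: "c \<in> atlas M"
  show "openin (points M) (fst c)"
    using chart_facts[OF c] by simp
  have "continuous_map (top_of_set (chart_image c)) euclidean (in_chart (immersion M) c)"
    using smooth_on_imp_continuous_on[OF immersion_smooth[OF c]] by simp
  then have "continuous_map (subtopology (points M) (fst c)) euclidean (in_chart (immersion M) c \<circ> snd c)"
    using chart_facts(4)[OF c] continuous_map_compose by blast
  then show "continuous_map (subtopology (points M) (fst c)) euclidean (immersion M)"
    by (rule continuous_map_eq) (use c in \<open>auto simp: in_chart_def\<close>)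
next
  fix x assume "x \<in> topspace (points M)"
  then show "\<exists>c. c \<in> atlas M \<and> x \<in> fst c \<and> immersion M x = immersion M x"
    using obtain_chart by metis
qed simp

text \<open>The straight segment from \<open>a\<close> to \<open>b\<close>, carried to
  \<open>M\<close> by \<open>\<psi>\<close>, is an admissible path of speed at most
  \<open>L\<close>. It is applied to inverse charts and to local sections of the projection.\<close>

lemma intrinsic_dist_param_le:
  fixes \<psi> :: "'b::euclidean_space \<Rightarrow> 'a"
  assumes \<psi>: "continuous_map (top_of_set B) (points M) \<psi>" and B: "open B" "closed_segment a b \<subseteq> B"
    and f': "C1_with_derivative (immersion M \<circ> \<psi>) B f'"
    and L: "\<And>z. z \<in> B \<Longrightarrow> norm (f' z (b - a)) \<le> L"
  shows "intrinsic_dist M (\<psi> a) (\<psi> b) \<le> ennreal L"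
proof -
  define l where "l t = a + t *\<^sub>R (b - a)" for t
  have l: "l t \<in> B" if "t \<in> {0..1}" for t
  proof -
    have "l t = (1 - t) *\<^sub>R a + t *\<^sub>R b"
      by (simp add: l_def algebra_simps)
    then show ?thesis
      using B(2) that by (auto simp: closed_segment_def)
  qed
  have cl: "continuous_on {0..1} l"
    unfolding l_def by (intro continuous_intros)
  have der: "(immersion M \<circ> (\<psi> \<circ> l) has_vector_derivative f' (l t) (b - a)) (at t)" if t: "t \<in> {0..1}" for t
  proof -
    have "((immersion M \<circ> \<psi>) \<circ> l has_derivative (blinfun_apply (f' (l t)) \<circ> (\<lambda>s. s *\<^sub>R (b - a)))) (at t)"
    proof (rule diff_chain_at)
      show "(l has_derivative (\<lambda>s. s *\<^sub>R (b - a))) (at t)"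
        unfolding l_def by (auto intro!: derivative_eq_intros)
    qed (use f' l[OF t] in \<open>simp add: C1_with_derivative_def\<close>)
    then show ?thesis
      by (simp add: has_vector_derivative_def o_def blinfun.scaleR_right)
  qed
  have "continuous_on {0..1} (\<lambda>t. f' (l t))"
  proof (rule continuous_on_compose2[OF _ cl])
    show "continuous_on B f'" "l ` {0..1} \<subseteq> B"
      using f' l unfolding C1_with_derivative_def by blast+
  qed
  then have "(immersion M \<circ> (\<psi> \<circ> l)) C1_differentiable_on {0..1}"
    unfolding C1_differentiable_on_def using der
    by (intro exI[of _ "\<lambda>t. f' (l t) (b - a)"]) (auto intro!: continuous_intros)
  moreover have "continuous_map (top_of_set {0..1}) (points M) (\<psi> \<circ> l)"
    using cl l by (intro continuous_map_compose[OF _ \<psi>]) (auto simp: continuous_map_in_subtopology)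
  ultimately have path: "surface_path M (\<psi> \<circ> l) (\<psi> a) (\<psi> b)"
    by (simp add: surface_path_def pathin_def C1_differentiable_imp_piecewise l_def)
  have "path_length (immersion M \<circ> (\<psi> \<circ> l)) \<le> (\<integral>\<^sup>+t\<in>{0..1::real}. ennreal L \<partial>lborel)"
    unfolding path_length_def
  proof (rule nn_integral_mono)
    fix t :: real
    show "ennreal (norm (vector_derivative (immersion M \<circ> (\<psi> \<circ> l)) (at t))) * indicator {0..1} t \<le> ennreal L * indicator {0..1} t"
    proof (cases "t \<in> {0..1}")
      case True
      then show ?thesis
        using vector_derivative_at[OF der[OF True]] L[OF l[OF True]] by (simp add: ennreal_leI)
    qed simp
  qed
  also have "\<dots> = ennreal L"
    by (simp add: nn_integral_cmult_indicator)
  finally show ?thesis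
    using intrinsic_dist_le[OF path] by simp
qed

text \<open>In a chart the derivative of the immersion is bounded near an interior point, so
  coordinate segments are short. Both orders of arguments are bounded: openness of intrinsic balls
  uses one, closedness of closed balls the other.\<close>

lemma intrinsic_dist_small:
  assumes x: "x \<in> topspace (points M)" "x \<notin> surface_boundary M" and \<eta>: "\<eta> > 0"
  shows "\<exists>V. openin (points M) V \<and> x \<in> V \<and>
    (\<forall>y\<in>V. intrinsic_dist M x y < ennreal \<eta> \<and> intrinsic_dist M y x < ennreal \<eta>)"
proof -
  obtain c where c: "c \<in> atlas M" "x \<in> fst c"
    using obtain_chart[OF x(1)] .
  obtain \<delta> f' where \<delta>: "\<delta> > 0" "ball (snd c x) \<delta> \<subseteq> chart_image c"
    and f': "C1_with_derivative (in_chart (immersion M) c) (ball (snd c x) \<delta>) f'"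
    using chart_C1[OF c x(2)] .
  define v b where "v = snd c x" and "b = norm (f' v) + 1"
  have "b > 0"
    by (simp add: b_def add_nonneg_pos)
  have "isCont f' v"
    using f' \<delta> by (auto simp: C1_with_derivative_def v_def continuous_on_eq_continuous_at)
  then obtain d0 where d0: "d0 > 0" "\<And>z. dist z v < d0 \<Longrightarrow> dist (f' z) (f' v) < 1"
    unfolding continuous_at_eps_delta using zero_less_one by blast
  \<comment> \<open>\<open>d0\<close> and \<open>\<delta>\<close> secure the derivative bound
    \<open>b\<close> and the chart domain; \<open>\<eta> / b\<close> turns coordinate distance below
    \<open>d\<close> into intrinsic distance below \<open>\<eta>\<close>.\<close>
  define d where "d = min (min d0 \<delta>) (\<eta> / b)"
  have d: "d > 0" "d \<le> d0" "d \<le> \<delta>" "d * b \<le> \<eta>"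
    using d0 \<delta> \<eta> \<open>b > 0\<close> by (auto simp: d_def simp flip: pos_le_divide_eq)
  let ?B = "ball v d"
  have sub: "?B \<subseteq> chart_image c" "?B \<subseteq> ball (snd c x) \<delta>"
    using \<delta> d by (auto simp: v_def)
  have \<psi>: "continuous_map (top_of_set ?B) (points M) (chart_inv c)"
    using chart_facts(5)[OF c(1)] sub continuous_map_from_subtopology_mono by blast
  have C1: "C1_with_derivative (immersion M \<circ> chart_inv c) ?B f'"
    using f' sub by (auto simp: C1_with_derivative_def in_chart_def intro: continuous_on_subset)
  have bnd: "norm (f' z) \<le> b" if "z \<in> ?B" for z
  proof -
    have "dist (f' z) (f' v) < 1"
      using that d d0(2)[of z] by (simp add: dist_commute)
    then show ?thesis
      using norm_triangle_ineq2[of "f' z" "f' v"] by (simp add: b_def dist_norm)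
  qed
  have le: "intrinsic_dist M (chart_inv c p) (chart_inv c q) < ennreal \<eta>"
    if pq: "p \<in> ?B" "q \<in> ?B" "norm (q - p) < d" for p q
  proof -
    have "intrinsic_dist M (chart_inv c p) (chart_inv c q) \<le> ennreal (b * norm (q - p))"
    proof (rule intrinsic_dist_param_le[OF \<psi> _ _ C1])
      show "closed_segment p q \<subseteq> ?B"
        using pq by (intro closed_segment_subset) auto
      show "norm (f' z (q - p)) \<le> b * norm (q - p)" if "z \<in> ?B" for z
        using norm_blinfun[of "f' z" "q - p"] mult_right_mono[OF bnd[OF that], of "norm (q - p)"] by simp
    qed simp
    also have "b * norm (q - p) < \<eta>"
      using mult_strict_left_mono[OF pq(3) \<open>b > 0\<close>] d by (simp add: mult.commute)
    then have "ennreal (b * norm (q - p)) < ennreal \<eta>"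
      using \<eta> by (simp add: ennreal_lessI)
    finally show ?thesis .
  qed
  show ?thesis
  proof (intro exI conjI ballI)
    show "openin (points M) (chart_inv c ` ?B)"
      using openin_chart_inv_image[OF c(1) _ sub(1)] by simp
    have v: "chart_inv c v = x" "v \<in> ?B"
      using c d by (auto simp: v_def)
    then show "x \<in> chart_inv c ` ?B"
      by force
    fix y assume "y \<in> chart_inv c ` ?B"
    then obtain q where "y = chart_inv c q" "q \<in> ?B"
      by blast
    then show "intrinsic_dist M x y < ennreal \<eta>" "intrinsic_dist M y x < ennreal \<eta>"
      using le[of v q] le[of q v] v by (simp_all add: dist_norm norm_minus_commute)
  qed
qed

end

subsection \<open>Local sections of the projection to a plane\<close>

context surface
begin

text \<open>\<open>immersed_surface\<close> speaks of the derivative within the chart image, which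
  at an interior point is the ordinary derivative.\<close>

lemma immersion_derivative_inj:
  assumes c: "c \<in> atlas M" and x: "x \<in> fst c" "x \<notin> surface_boundary M"
    and f': "(in_chart (immersion M) c has_derivative f') (at (snd c x))"
  shows "inj f'"
proof -
  have v: "snd c x \<in> interior (chart_image c)"
    by (rule chart_in_interior[OF c x])
  then have "inj (frechet_derivative (in_chart (immersion M) c) (at (snd c x) within chart_image c))"
    using immersed c interior_subset unfolding immersed_surface_def by blast
  then show ?thesis
    using at_within_interior[OF v] frechet_derivative_at[OF f'] by simp
qed

text \<open>The slope bound makes \<open>L\<close> injective on tangent planes, so in a chart the
  projection is a map between planes with invertible derivative and the inverse function theorem
  applies. The same bound limits the speed of a lifted segment to \<open>C\<close> times that of the
  segment.\<close>

lemma locally_sectioned_projection: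
  fixes L :: "real^3 \<Rightarrow> real^2"
  assumes L: "linear L" and U: "openin (points M) U" "U \<inter> surface_boundary M = {}"
    and slope: "\<And>c x f' u. c \<in> atlas M \<Longrightarrow> x \<in> fst c \<Longrightarrow> x \<in> U \<Longrightarrow>
      (in_chart (immersion M) c has_derivative f') (at (snd c x)) \<Longrightarrow> norm (f' u) \<le> C * norm (L (f' u))"
  shows "locally_sectioned (points M) (\<lambda>x. L (immersion M x)) (intrinsic_dist M) C U"
  unfolding locally_sectioned_def
proof
  fix y assume y: "y \<in> U"
  let ?h = "\<lambda>x. L (immersion M x)"
  have y_nb: "y \<notin> surface_boundary M" and "y \<in> topspace (points M)"
    using U y openin_subset by blast+
  then obtain c where c: "c \<in> atlas M" "y \<in> fst c"
    using obtain_chart by metis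
  let ?f = "in_chart (immersion M) c"
  define v where "v = snd c y"
  obtain \<delta> f' where \<delta>: "\<delta> > 0" "ball v \<delta> \<subseteq> chart_image c" and f': "C1_with_derivative ?f (ball v \<delta>) f'"
    using chart_C1[OF c y_nb] unfolding v_def by metis
  \<comment> \<open>Coordinates are restricted to points of \<open>U\<close>, where the slope bound
    is available.\<close>
  define B where "B = {z \<in> ball v \<delta>. chart_inv c z \<in> U}"
  have \<psi>: "continuous_map (top_of_set (ball v \<delta>)) (points M) (chart_inv c)"
    using chart_facts(5)[OF c(1)] \<delta>(2) continuous_map_from_subtopology_mono by blast
  have "openin (top_of_set (ball v \<delta>)) B"
    using openin_continuous_map_preimage[OF \<psi> U(1)] by (simp add: B_def)
  then have B: "open B" "B \<subseteq> ball v \<delta>" "v \<in> B"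
    using openin_open_trans[OF _ open_ball] c y \<delta>(1) by (auto simp: B_def v_def)
  have derf: "(?f has_derivative f' z) (at z)" if "z \<in> B" for z
    using f' B(2) that by (auto simp: C1_with_derivative_def)
  have in_U: "chart_inv c z \<in> fst c" "chart_inv c z \<in> U" "snd c (chart_inv c z) = z" if "z \<in> B" for z
  proof -
    have z: "z \<in> chart_image c"
      using that B(2) \<delta>(2) by blast
    show "chart_inv c z \<in> fst c" "snd c (chart_inv c z) = z"
      using chart_inv_in[OF z] chart_chart_inv[OF z] .
    show "chart_inv c z \<in> U"
      using that by (simp add: B_def)
  qed
  have slope': "norm (f' z u) \<le> C * norm (L (f' z u))" if "z \<in> B" for z u
    using slope[OF c(1) in_U(1,2)[OF that], of "f' z" u] derf[OF that] in_U(3)[OF that] by simp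
  define BL where "BL = Blinfun L"
  have BL: "blinfun_apply BL = L"
    unfolding BL_def using L by (intro bounded_linear_Blinfun_apply) (simp add: linear_linear)
  define k k' where "k z = L (?f z)" and "k' z = BL o\<^sub>L f' z" for z
  have k'_apply: "k' z u = L (f' z u)" for z u
    by (simp add: k'_def BL)
  have derk: "(k has_derivative blinfun_apply (k' z)) (at z)" if "z \<in> B" for z
  proof -
    have "(L has_derivative L) (at (?f z))"
      using L by (simp add: linear_imp_has_derivative)
    then show ?thesis
      using diff_chain_at[OF derf[OF that]] unfolding k_def k'_def by (simp add: blinfun_compose.rep_eq o_def BL)
  qed
  have "continuous_on B f'"
    using f' B(2) continuous_on_subset by (auto simp: C1_with_derivative_def)
  then have contk': "continuous_on B k'"
    unfolding k'_def by (intro bounded_bilinear.continuous_on[OF bounded_bilinear_blinfun_compose] continuous_on_const)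
  have "inj (blinfun_apply (k' v))"
  proof (rule linear_injective_0[THEN iffD2], simp add: bounded_linear.linear blinfun.bounded_linear_right, intro allI impI)
    fix u assume "k' v u = 0"
    then have "f' v u = 0"
      using slope'[OF B(3), of u] by (simp add: k'_apply)
    moreover have "inj (f' v)"
      using immersion_derivative_inj[OF c y_nb] derf[OF B(3)] by (simp add: v_def)
    ultimately show "u = 0"
      by (metis blinfun.zero_right injD)
  qed
  then obtain i where i: "linear i" "\<And>u. i (k' v u) = u"
    using linear_injective_isomorphism[of "k' v"] blinfun.bounded_linear_right bounded_linear.linear by metis
  have inv: "Blinfun i o\<^sub>L k' v = id_blinfun"
    using i by (intro blinfun_eqI) (simp add: bounded_linear_Blinfun_apply linear_linear)
  obtain U' V g g' where "open U'" and U': "U' \<subseteq> B" "v \<in> U'" and V: "open V" "k v \<in> V" and hom: "homeomorphism U' V k g"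
    and g': "\<And>w. w \<in> V \<Longrightarrow> (g has_derivative g' w) (at w)" "\<And>w. w \<in> V \<Longrightarrow> g' w = inv (blinfun_apply (k' (g w)))"
    and bij: "\<And>w. w \<in> V \<Longrightarrow> bij (blinfun_apply (k' (g w)))"
    using inverse_function_theorem[OF B(1) derk contk' B(3) inv] by metis
  have gU: "g w \<in> U'" "k (g w) = w" if "w \<in> V" for w
    using hom that by (auto simp: homeomorphism_def)
  have contg: "continuous_on V g"
    using hom by (simp add: homeomorphism_def)
  define G where "G w = Blinfun (g' w)" for w
  have G: "blinfun_apply (G w) = g' w" if "w \<in> V" for w
    unfolding G_def using g'(1)[OF that] has_derivative_bounded_linear by (intro bounded_linear_Blinfun_apply) blast
  have contG: "continuous_on V G"
  proof (rule continuous_on_blinfun_inverse)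
    show "continuous_on V (\<lambda>w. k' (g w))"
      using continuous_on_compose2[OF contk' contg] gU U' by blast
    fix w assume w: "w \<in> V"
    show "k' (g w) o\<^sub>L G w = id_blinfun" "G w o\<^sub>L k' (g w) = id_blinfun"
      using bij[OF w] g'(2)[OF w] G[OF w]
      by (auto intro!: blinfun_eqI simp: bij_def surj_f_inv_f inv_f_f)
  qed
  obtain \<epsilon> where \<epsilon>: "\<epsilon> > 0" "ball (k v) \<epsilon> \<subseteq> V"
    using V open_contains_ball by blast
  have kv: "?h y = k v"
    using c by (simp add: k_def in_chart_apply v_def)
  let ?B = "ball (k v) \<epsilon>" and ?\<tau> = "\<lambda>w. chart_inv c (g w)"
  have gB: "g w \<in> B" "g w \<in> U'" "k (g w) = w" if "w \<in> ?B" for w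
    using gU[of w] U'(1) \<epsilon>(2) that by blast+
  have h\<tau>: "?h (chart_inv c z) = k z" for z
    by (simp add: k_def in_chart_apply)
  have "continuous_on ?B g"
    using contg \<epsilon>(2) continuous_on_subset by blast
  then have "continuous_map (top_of_set ?B) (top_of_set (ball v \<delta>)) g"
    using gB(1) B(2) by (auto simp: continuous_map_in_subtopology)
  then have cont\<tau>: "continuous_map (top_of_set ?B) (points M) ?\<tau>"
    using continuous_map_compose[OF _ \<psi>, of _ g] by (simp add: o_def)
  have C1: "C1_with_derivative (immersion M \<circ> ?\<tau>) ?B (\<lambda>w. f' (g w) o\<^sub>L G w)"
    unfolding C1_with_derivative_def
  proof (intro conjI ballI)
    fix w assume w: "w \<in> ?B"
    then have "w \<in> V"
      using \<epsilon>(2) by blast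
    have "(?f \<circ> g has_derivative (blinfun_apply (f' (g w)) \<circ> g' w)) (at w)"
      using diff_chain_at[OF g'(1)[OF \<open>w \<in> V\<close>] derf[OF gB(1)[OF w]]] .
    then show "(immersion M \<circ> ?\<tau> has_derivative blinfun_apply (f' (g w) o\<^sub>L G w)) (at w)"
      using G[OF \<open>w \<in> V\<close>] by (simp add: blinfun_compose.rep_eq o_def in_chart_apply)
  next
    have "continuous_on ?B (\<lambda>w. f' (g w))"
      using continuous_on_compose2[OF \<open>continuous_on B f'\<close> \<open>continuous_on ?B g\<close>] gB(1) by blast
    then show "continuous_on ?B (\<lambda>w. f' (g w) o\<^sub>L G w)"
      using continuous_on_subset[OF contG \<epsilon>(2)]
      by (rule bounded_bilinear.continuous_on[OF bounded_bilinear_blinfun_compose])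
  qed
  have "lipschitz_section (points M) ?h (intrinsic_dist M) C U ?B ?\<tau>"
    unfolding lipschitz_section_def section_on_def
  proof (intro conjI ballI cont\<tau>)
    show "?\<tau> ` ?B \<subseteq> U"
      using gB(1) in_U(2) by blast
    show "?h (?\<tau> w) = w" if "w \<in> ?B" for w
      using gB(3)[OF that] h\<tau> by simp
    fix w w' assume w: "w \<in> ?B" "w' \<in> ?B"
    show "intrinsic_dist M (?\<tau> w) (?\<tau> w') \<le> ennreal (C * norm (w - w'))"
    proof (rule intrinsic_dist_param_le[OF cont\<tau> open_ball _ C1])
      show "closed_segment w w' \<subseteq> ?B"
        using w by (intro closed_segment_subset) auto
      fix z assume z: "z \<in> ?B"
      then have "z \<in> V"
        using \<epsilon>(2) by blast
      \<comment> \<open>The velocity of the lifted segment projects exactly to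
        \<open>w' - w\<close>, which is what the slope bound compares it with.\<close>
      have "k' (g z) (G z (w' - w)) = w' - w"
        using bij[OF \<open>z \<in> V\<close>] g'(2)[OF \<open>z \<in> V\<close>] G[OF \<open>z \<in> V\<close>] by (simp add: bij_def surj_f_inv_f)
      then show "norm ((f' (g z) o\<^sub>L G z) (w' - w)) \<le> C * norm (w - w')"
        using slope'[OF gB(1)[OF z], of "G z (w' - w)"] by (simp add: k'_apply norm_minus_commute)
    qed
  qed
  \<comment> \<open>Intersecting with the preimage of the ball makes every point of this
    neighbourhood project into the domain of the section.\<close>
  moreover have "openin (points M) (chart_inv c ` (U' \<inter> k -` ?B))"
  proof (rule openin_chart_inv_image[OF c(1)])
    have "continuous_on U' k"
      using hom by (simp add: homeomorphism_def)
    then show "open (U' \<inter> k -` ?B)"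
      using \<open>open U'\<close> continuous_open_preimage by blast
    show "U' \<inter> k -` ?B \<subseteq> chart_image c"
      using U' B \<delta> by blast
  qed
  moreover have "y \<in> chart_inv c ` (U' \<inter> k -` ?B)"
    using c U'(2) \<epsilon>(1) by (auto simp: v_def intro!: image_eqI[of y _ v])
  moreover have "?h y' \<in> ?B \<and> ?\<tau> (?h y') = y'" if "y' \<in> chart_inv c ` (U' \<inter> k -` ?B)" for y'
    using that hom h\<tau> by (auto simp: homeomorphism_def)
  ultimately show "\<exists>\<epsilon>>0. \<exists>V \<tau>. openin (points M) V \<and> y \<in> V \<and>
      lipschitz_section (points M) ?h (intrinsic_dist M) C U (ball (?h y) \<epsilon>) \<tau> \<and>
      (\<forall>y'\<in>V. ?h y' \<in> ball (?h y) \<epsilon> \<and> \<tau> (?h y') = y')"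
    unfolding kv using \<epsilon>(1) by blast
qed

text \<open>\<open>gauss_map\<close> is computed in the chart picked by \<open>chart_at\<close>, the
  slope bound in an arbitrary one. The chain rule for the transition map identifies their tangent
  vectors.\<close>

lemma tangent_chart_change:
  assumes c: "c \<in> atlas M" "x \<in> fst c" and d: "d \<in> atlas M" "x \<in> fst d" and x: "x \<notin> surface_boundary M"
    and c': "(in_chart (immersion M) c has_derivative c') (at (snd c x))"
    and d': "(in_chart (immersion M) d has_derivative d') (at (snd d x))"
  obtains u' where "c' u = d' u'"
proof -
  define S \<tau> v where "S = snd c ` (fst c \<inter> fst d)" and "\<tau> = in_chart (snd d) c" and "v = snd c x"
  have "oriented_compatible c d"
    using immersed c d by (auto simp: immersed_surface_def)
  then have smooth: "smooth_on S \<tau>"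
    by (simp add: oriented_compatible_def Let_def S_def \<tau>_def)
  have \<tau>: "\<tau> z = snd d (chart_inv c z)" for z
    by (simp add: \<tau>_def in_chart_apply)
  have inS: "chart_inv c z \<in> fst d" if "z \<in> S" for z
    using that c(1) by (auto simp: S_def)
  \<comment> \<open>An open set around \<open>v\<close> inside \<open>S\<close>, so that the
    transition map has an ordinary derivative at \<open>v\<close>.\<close>
  let ?T = "{z \<in> interior (chart_image c). chart_inv c z \<in> fst d}"
  have "continuous_map (top_of_set (interior (chart_image c))) (points M) (chart_inv c)"
    using chart_facts(5)[OF c(1)] interior_subset continuous_map_from_subtopology_mono by blast
  then have "openin (top_of_set (interior (chart_image c))) ?T"
    using openin_continuous_map_preimage[OF _ chart_facts(1)[OF d(1)]] by fastforce
  then have "open ?T"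
    using openin_open_trans by blast
  moreover have "v \<in> ?T"
    using chart_in_interior[OF c x] c d by (simp add: v_def)
  moreover have "?T \<subseteq> S"
  proof
    fix z assume z: "z \<in> ?T"
    then have "z \<in> chart_image c"
      using interior_subset by blast
    then show "z \<in> S"
      unfolding S_def using z chart_inv_in[of z c] chart_chart_inv[of z c] by (metis (no_types, lifting) IntI image_eqI mem_Collect_eq)
  qed
  ultimately have "v \<in> interior S"
    by (meson interiorI)
  then obtain \<delta> f' where \<delta>: "\<delta> > 0" "ball v \<delta> \<subseteq> S" and f': "C1_with_derivative \<tau> (ball v \<delta>) f'"
    using smooth_on_imp_C1[OF smooth] by metis
  have "(\<tau> has_derivative f' v) (at v)"
    using f' \<delta> by (simp add: C1_with_derivative_def)
  moreover have "\<tau> v = snd d x"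
    using c by (simp add: \<tau> v_def)
  ultimately have "(in_chart (immersion M) d \<circ> \<tau> has_derivative (d' \<circ> f' v)) (at v)"
    using diff_chain_at d' by metis
  then have "(in_chart (immersion M) c has_derivative (d' \<circ> f' v)) (at v)"
  proof (rule has_derivative_transform_within_open)
    show "open (ball v \<delta>)" "v \<in> ball v \<delta>"
      using \<delta> by auto
    fix z assume "z \<in> ball v \<delta>"
    then show "(in_chart (immersion M) d \<circ> \<tau>) z = in_chart (immersion M) c z"
      using \<delta>(2) inS d(1) by (auto simp: in_chart_apply \<tau>)
  qed
  then have "c' = d' \<circ> f' v"
    using c' has_derivative_unique v_def by blast
  then show ?thesis
    using that[of "f' v u"] by simp
qed

end

section \<open>Tilt, rotations and projection of tangent vectors to the horizontal plane\<close>

definition proj12 :: "real^3 \<Rightarrow> real^2" where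
  "proj12 w = vector [w $ 1, w $ 2]"

lemma linear_proj12: "linear proj12"
  by (rule linearI) (auto simp: proj12_def vec_eq_iff forall_2)

lemma norm_proj12_sq: "(norm (proj12 w))\<^sup>2 = (w $ 1)\<^sup>2 + (w $ 2)\<^sup>2"
  by (simp add: proj12_def norm_vec_def L2_set_def sum_2)

lemma norm_proj12_le: "norm (proj12 w) \<le> norm w"
proof (rule power2_le_imp_le)
  show "(norm (proj12 w))\<^sup>2 \<le> (norm w)\<^sup>2"
    unfolding norm_proj12_sq by (simp add: norm_vec_def L2_set_def sum_3)
qed simp

text \<open>Orthogonality expresses the third coordinate of \<open>w\<close> by the first two. With
  squared third coordinate of \<open>\<nu>\<close> at least 4/9, the other two squares sum to at
  most 5/9, so the vertical part of \<open>w\<close> contributes at most 5/4 of the squared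
  projection, and 1 + 5/4 = (3/2)^2.\<close>

lemma norm_le_proj12:
  fixes w \<nu> :: "real^3"
  assumes \<nu>: "norm \<nu> \<le> 1" "\<nu> \<bullet> w = 0" "\<nu> \<bullet> e3 \<ge> 2/3"
  shows "norm w \<le> 3/2 * norm (proj12 w)"
proof -
  have "(norm \<nu>)\<^sup>2 \<le> 1"
    using \<nu>(1) by (simp add: power_le_one)
  then have 1: "(\<nu> $ 1)\<^sup>2 + (\<nu> $ 2)\<^sup>2 + (\<nu> $ 3)\<^sup>2 \<le> 1"
    by (simp add: norm_vec_def L2_set_def sum_3)
  have 2: "\<nu> $ 3 * w $ 3 = - (\<nu> $ 1 * w $ 1 + \<nu> $ 2 * w $ 2)"
    using \<nu>(2) by (simp add: inner_vec_def sum_3)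
  have "\<nu> $ 3 \<ge> 2/3"
    using \<nu>(3) by (simp add: inner_vec_def sum_3 e3_def)
  then have 3: "(\<nu> $ 3)\<^sup>2 \<ge> 4/9"
    using power_mono[of "2/3" "\<nu> $ 3" 2] by (simp add: power2_eq_square)
  let ?p = "(w $ 1)\<^sup>2 + (w $ 2)\<^sup>2"
  have "4/9 * (w $ 3)\<^sup>2 \<le> (\<nu> $ 3)\<^sup>2 * (w $ 3)\<^sup>2"
    using 3 by (intro mult_right_mono) auto
  also have "\<dots> = (\<nu> $ 1 * w $ 1 + \<nu> $ 2 * w $ 2)\<^sup>2"
    using 2 by (metis power2_minus power_mult_distrib)
  \<comment> \<open>Cauchy-Schwarz in the plane: the two sides differ by exactly the square
    introduced here.\<close>
  also have "\<dots> \<le> ((\<nu> $ 1)\<^sup>2 + (\<nu> $ 2)\<^sup>2) * ?p"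
    using zero_le_power2[of "\<nu> $ 1 * w $ 2 - \<nu> $ 2 * w $ 1"]
    by (simp add: power2_eq_square algebra_simps)
  also have "\<dots> \<le> 5/9 * ?p"
    using 1 3 by (intro mult_right_mono) auto
  finally have "(norm w)\<^sup>2 \<le> (3/2 * norm (proj12 w))\<^sup>2"
    unfolding power_mult_distrib norm_proj12_sq
    by (simp add: norm_vec_def L2_set_def sum_3 power2_eq_square)
  then show ?thesis
    by (rule power2_le_imp_le) simp
qed

lemma norm_rotation:
  fixes Q :: "real^'n^'n"
  assumes "rotation_matrix Q"
  shows "norm (Q *v w) = norm w"
proof -
  have "orthogonal_transformation ((*v) Q)"
    unfolding orthogonal_transformation_matrix matrix_of_matrix_vector_mul
    using assms matrix_vector_mul_linear by (auto simp only: rotation_matrix_def)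
  then show ?thesis
    by (rule orthogonal_transformation_norm)
qed

text \<open>An inequality, so that it holds at every point of every surface: a vanishing cross
  product is normalised to 0.\<close>

lemma norm_gauss_map_le: "norm (gauss_map M x) \<le> 1"
proof -
  have "norm (n /\<^sub>R norm n) \<le> 1" for n :: "real^3"
    by (cases "n = 0") auto
  then show ?thesis
    by (simp only: gauss_map_def Let_def)
qed

lemma abs_gauss_map_e3_le: "\<bar>gauss_map M x \<bullet> e3\<bar> \<le> 1"
proof -
  have "norm e3 = 1"
    by (simp add: e3_def norm_vec_def L2_set_def sum_3)
  then show ?thesis
    using Cauchy_Schwarz_ineq2[of "gauss_map M x" e3] norm_gauss_map_le[of M x] by simp
qed

text \<open>The upper bound makes suprema of \<open>tilt\<close> genuine, so that pointwise bounds
  can be read off from them.\<close>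

lemma tilt_bounds: "0 \<le> tilt M x" "tilt M x \<le> sqrt 2"
  using abs_gauss_map_e3_le[of M x] by (auto simp: tilt_def)

lemma tilt_le_imp:
  assumes "tilt M x \<le> 1 / sqrt 3"
  shows "gauss_map M x \<bullet> e3 \<ge> 2/3"
proof -
  have "1 - gauss_map M x \<bullet> e3 = (tilt M x)\<^sup>2"
    using abs_gauss_map_e3_le[of M x] by (simp add: tilt_def)
  also have "\<dots> \<le> (1 / sqrt 3)\<^sup>2"
    using assms tilt_bounds by (intro power_mono) auto
  finally show ?thesis
    by (simp add: power_divide)
qed

context surface
begin

lemma chart_at_M:
  assumes "x \<in> topspace (points M)"
  shows "chart_at M x \<in> atlas M" "x \<in> fst (chart_at M x)"
proof -
  have "\<exists>c. c \<in> atlas M \<and> x \<in> fst c"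
    using obtain_chart[OF assms] by metis
  then show "chart_at M x \<in> atlas M" "x \<in> fst (chart_at M x)"
    unfolding chart_at_def by (metis (mono_tags, lifting) someI_ex)+
qed

text \<open>The Gauss map of the rotated surface is unfolded directly instead of being compared with
  that of \<open>M\<close>: it is a normalised cross product of the images under \<open>Q\<close> of
  two coordinate tangent vectors, and these span the image of the tangent plane.\<close>

lemma gauss_map_rotate_orthogonal:
  fixes Q :: "real^3^3"
  assumes x: "x \<in> topspace (points M)" "x \<notin> surface_boundary M"
    and c: "c \<in> atlas M" "x \<in> fst c"
    and f': "(in_chart (immersion M) c has_derivative f') (at (snd c x))"
  shows "gauss_map (rotate_surface Q M) x \<bullet> (Q *v f' u) = 0"
proof -
  define d where "d = chart_at M x"
  have d: "d \<in> atlas M" "x \<in> fst d"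
    using chart_at_M[OF x(1)] by (auto simp: d_def)
  obtain \<delta> F where "\<delta> > 0" "C1_with_derivative (in_chart (immersion M) d) (ball (snd d x) \<delta>) F"
    using chart_C1[OF d x(2)] by metis
  then have F: "(in_chart (immersion M) d has_derivative F (snd d x)) (at (snd d x))"
    by (simp add: C1_with_derivative_def)
  define D where "D = (\<lambda>u. Q *v F (snd d x) u)"
  have "((\<lambda>z. Q *v in_chart (immersion M) d z) has_derivative D) (at (snd d x))"
    unfolding D_def using bounded_linear.has_derivative[OF matrix_vector_mul_bounded_linear F] .
  then have "(in_chart (immersion (rotate_surface Q M)) d has_derivative D) (at (snd d x))"
    by (simp add: in_chart_def rotate_surface_def o_def)
  \<comment> \<open>Rotation leaves the atlas unchanged, so \<open>chart_at\<close> picks the same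
    chart \<open>d\<close> for both surfaces.\<close>
  then have sd: "surface_deriv (rotate_surface Q M) (immersion (rotate_surface Q M)) x = D"
    using at_within_interior[OF chart_in_interior[OF d x(2)]]
    by (simp add: surface_deriv_def chart_at_def d_def[unfolded chart_at_def, symmetric] rotate_surface_def frechet_derivative_at[symmetric] Let_def)
  obtain u' where u': "f' u = F (snd d x) u'"
    using tangent_chart_change[OF c d x(2) f' F] .
  have eq: "u' = u' $ 1 *\<^sub>R axis 1 1 + u' $ 2 *\<^sub>R axis 2 1"
    by (simp add: vec_eq_iff forall_2 axis_def)
  have lin: "linear D"
    using linear_compose[OF has_derivative_linear[OF F] matrix_vector_mul_linear[of Q]] by (simp add: o_def D_def)
  have "D u' = D (u' $ 1 *\<^sub>R axis 1 1 + u' $ 2 *\<^sub>R axis 2 1)"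
    using eq by (rule arg_cong)
  also have "\<dots> = u' $ 1 *\<^sub>R D (axis 1 1) + u' $ 2 *\<^sub>R D (axis 2 1)"
    using lin by (simp add: linear_add linear_scale)
  finally have "Q *v f' u = u' $ 1 *\<^sub>R D (axis 1 1) + u' $ 2 *\<^sub>R D (axis 2 1)"
    by (simp add: u' D_def)
  then show ?thesis
    by (simp add: gauss_map_def Let_def sd inner_add_right dot_cross_self inner_commute)
qed

lemma rotated_tilt_slope:
  fixes Q :: "real^3^3"
  assumes Q: "rotation_matrix Q"
    and x: "x \<in> topspace (points M)" "x \<notin> surface_boundary M"
    and tilt: "tilt (rotate_surface Q M) x \<le> 1 / sqrt 3"
    and c: "c \<in> atlas M" "x \<in> fst c"
    and f': "(in_chart (immersion M) c has_derivative f') (at (snd c x))"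
  shows "norm (f' u) \<le> 3/2 * norm (proj12 (Q *v f' u))"
proof -
  have "norm (Q *v f' u) \<le> 3/2 * norm (proj12 (Q *v f' u))"
    using norm_gauss_map_le gauss_map_rotate_orthogonal[OF x c f'] tilt_le_imp[OF tilt]
    by (rule norm_le_proj12)
  then show ?thesis
    by (simp add: norm_rotation[OF Q])
qed

end

subsection \<open>The component inside an intrinsic ball\<close>

context surface
begin

lemma immersion_norm_less:
  assumes "y \<in> intrinsic_ball M x0 \<rho>" "immersion M x0 = 0"
  shows "norm (immersion M y) < \<rho>"
  using assms norm_immersion_diff_le[of M y x0] by (auto simp: intrinsic_ball_def ennreal_less_iff dest: le_less_trans)

text \<open>The triangle inequality together with \<open>intrinsic_dist_small\<close>, which speaks
  only of points off the boundary.\<close>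

lemma openin_intrinsic_ball:
  assumes "intrinsic_ball M x0 \<rho> \<inter> surface_boundary M = {}"
  shows "openin (points M) (intrinsic_ball M x0 \<rho>)"
proof (subst openin_subopen, intro ballI)
  fix y assume y: "y \<in> intrinsic_ball M x0 \<rho>"
  then have yd: "intrinsic_dist M x0 y < ennreal \<rho>" "y \<in> topspace (points M)" "y \<notin> surface_boundary M"
    using assms by (auto simp: intrinsic_ball_def)
  then obtain a where a: "0 \<le> a" "intrinsic_dist M x0 y = ennreal a"
    by (cases "intrinsic_dist M x0 y") auto
  with yd have "a < \<rho>"
    by (simp add: ennreal_less_iff)
  then obtain V where V: "openin (points M) V" "y \<in> V"
      "\<forall>z\<in>V. intrinsic_dist M y z < ennreal (\<rho> - a)"
    using intrinsic_dist_small[OF yd(2,3), of "\<rho> - a"] by auto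
  have "z \<in> intrinsic_ball M x0 \<rho>" if z: "z \<in> V" for z
  proof -
    have "intrinsic_dist M x0 z \<le> ennreal a + intrinsic_dist M y z"
      using intrinsic_dist_triangle[of M x0 z y] a by simp
    also have "\<dots> < ennreal a + ennreal (\<rho> - a)"
      using V(3) z by (simp add: ennreal_add_left_cancel_less)
    also have "\<dots> = ennreal \<rho>"
      using a \<open>a < \<rho>\<close> by (simp flip: ennreal_plus)
    finally show ?thesis
      using z V(1) openin_subset by (auto simp: intrinsic_ball_def)
  qed
  then show "\<exists>T. openin (points M) T \<and> y \<in> T \<and> T \<subseteq> intrinsic_ball M x0 \<rho>"
    using V by blast
qed

text \<open>A point outside the set whose image lies in the closed ball of radius \<open>a\<close>
  is off the boundary, and small intrinsic neighbourhoods separate it. Any other point, boundary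
  points included, is separated by the continuous immersion, which maps the set into that closed
  ball.\<close>

lemma closedin_intrinsic_cball:
  assumes x0: "immersion M x0 = 0" and a: "0 \<le> a"
    and nb: "\<And>y. y \<in> topspace (points M) \<Longrightarrow> norm (immersion M y) \<le> a \<Longrightarrow> y \<notin> surface_boundary M"
  shows "closedin (points M) {y \<in> topspace (points M). intrinsic_dist M x0 y \<le> ennreal a}"
proof -
  let ?K = "{y \<in> topspace (points M). intrinsic_dist M x0 y \<le> ennreal a}"
  have "openin (points M) (topspace (points M) - ?K)"
  proof (subst openin_subopen, intro ballI)
    fix y assume y: "y \<in> topspace (points M) - ?K"
    show "\<exists>T. openin (points M) T \<and> y \<in> T \<and> T \<subseteq> topspace (points M) - ?K"
    proof (cases "norm (immersion M y) \<le> a")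
      case True
      have gt: "ennreal a < intrinsic_dist M x0 y"
        using y by auto
      have top: "y \<in> topspace (points M)"
        using y by simp
      \<comment> \<open>The distance may be infinite, so the gap is measured by a real
        \<open>b\<close> strictly between \<open>a\<close> and it.\<close>
      obtain e where e: "ennreal a < e" "e < intrinsic_dist M x0 y"
        using dense[OF gt] by blast
      then obtain b where "e = ennreal b" "0 \<le> b"
        by (cases e) auto
      then have b: "a < b" "ennreal b < intrinsic_dist M x0 y"
        using e a by (auto simp: ennreal_less_iff)
      then have "0 < b - a"
        by simp
      obtain V where V: "openin (points M) V" "y \<in> V"
          "\<forall>z\<in>V. intrinsic_dist M z y < ennreal (b - a)"
        using intrinsic_dist_small[OF top nb[OF top True], of "b - a"] \<open>0 < b - a\<close> by blast
      have "z \<notin> ?K" if z: "z \<in> V" for z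
      proof
        assume "z \<in> ?K"
        have "intrinsic_dist M x0 y \<le> intrinsic_dist M x0 z + intrinsic_dist M z y"
          by (rule intrinsic_dist_triangle)
        also have "\<dots> \<le> ennreal a + ennreal (b - a)"
          using \<open>z \<in> ?K\<close> V(3) z by (intro add_mono) (auto intro: less_imp_le)
        also have "\<dots> = ennreal b"
          using a b by (simp flip: ennreal_plus)
        finally show False
          using b by simp
      qed
      then show ?thesis
        using V openin_subset by blast
    next
      case False
      let ?T = "{z \<in> topspace (points M). immersion M z \<in> - cball 0 a}"
      have "openin (points M) ?T"
        by (rule openin_continuous_map_preimage[OF continuous_immersion]) (auto simp: open_Compl)
      moreover have "z \<notin> ?K" if z: "z \<in> ?T" for z
      proof
        assume "z \<in> ?K"
        then have "ennreal (norm (immersion M z)) \<le> ennreal a"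
          using norm_immersion_diff_le[of M z x0] x0 by auto
        then show False
          using z a by simp
      qed
      ultimately show ?thesis
        using y False by (intro exI[of _ ?T]) auto
    qed
  qed
  then show ?thesis
    by (auto simp: closedin_def)
qed

text \<open>\<open>L\<close> does not increase norms, so \<open>S\<close> projects into the disc of
  radius \<open>\<rho> / 2\<close>. Lifts of radii of that disc have length at most
  \<open>C * \<rho> / 2\<close>, below \<open>\<rho>\<close> because \<open>C < 2\<close>, so they
  never leave the region where the slope bound is assumed.\<close>

theorem component_subset_intrinsic_ball:
  fixes L :: "real^3 \<Rightarrow> real^2"
  assumes compact: "compact_space (points M)"
    and x0: "x0 \<in> topspace (points M)" "immersion M x0 = 0"
    and boundary: "immersion M ` surface_boundary M \<subseteq> sphere 0 R"
    and \<rho>: "0 < \<rho>" "\<rho> < R" and C: "0 < C" "C < 2"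
    and L: "linear L" "\<And>w. norm (L w) \<le> norm w"
    and slope: "\<And>c x f' u. c \<in> atlas M \<Longrightarrow> x \<in> fst c \<Longrightarrow> x \<in> intrinsic_ball M x0 \<rho> \<Longrightarrow>
      (in_chart (immersion M) c has_derivative f') (at (snd c x)) \<Longrightarrow> norm (f' u) \<le> C * norm (L (f' u))"
    and S: "connectedin (points M) S" "immersion M ` S \<subseteq> ball 0 (\<rho> / 2)" "x0 \<in> S"
  shows "S \<subseteq> intrinsic_ball M x0 \<rho>"
proof -
  let ?X = "points M" and ?U = "intrinsic_ball M x0 \<rho>" and ?h = "\<lambda>x. L (immersion M x)"
  have X: "Hausdorff_space ?X"
    using immersed by (simp add: immersed_surface_def)
  have nb: "y \<notin> surface_boundary M" if "norm (immersion M y) < R" for y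
    using that boundary by force
  have U: "?U \<inter> surface_boundary M = {}"
    using immersion_norm_less[OF _ x0(2)] nb \<rho>(2) by fastforce
  have x0_nb: "x0 \<notin> surface_boundary M"
    using \<rho> by (intro nb) (simp add: x0(2))
  then have "intrinsic_dist M x0 x0 < ennreal \<rho>"
    using intrinsic_dist_small[OF x0(1) x0_nb \<rho>(1)] by blast
  then have x0U: "x0 \<in> ?U"
    using x0(1) by (simp add: intrinsic_ball_def)
  \<comment> \<open>Chosen so that the disc of radius \<open>a / C\<close> supplied by
    \<open>radial_section\<close> is exactly the one containing the projection of
    \<open>S\<close>.\<close>
  define a where "a = C * \<rho> / 2"
  have a: "0 < a" "a < \<rho>" "a / C = \<rho> / 2"
    using C \<rho>(1) by (auto simp: a_def)
  let ?K = "{y \<in> topspace ?X. intrinsic_dist M x0 y \<le> ennreal a}"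
  have "closedin ?X ?K"
    using a \<rho>(2) by (intro closedin_intrinsic_cball[OF x0(2)] nb) auto
  then have K: "compactin ?X ?K"
    using compact closedin_compact_space by blast
  have KU: "?K \<subseteq> ?U"
    using a le_less_trans[OF _ ennreal_lessI[of \<rho> a]] by (auto simp: intrinsic_ball_def)
  have cont: "continuous_map ?X euclidean ?h"
  proof -
    have "continuous_map euclidean euclidean L"
      using linear_continuous_on[OF linear_conv_bounded_linear[THEN iffD1, OF L(1)], of UNIV] by simp
    then show ?thesis
      using continuous_map_compose[OF continuous_immersion, of euclidean L] by (simp add: o_def)
  qed
  have ls: "locally_sectioned ?X ?h (intrinsic_dist M) C ?U"
  proof (rule locally_sectioned_projection[OF L(1) openin_intrinsic_ball[OF U] U])
    fix c x f' u
    assume "c \<in> atlas M" "x \<in> fst c" "x \<in> ?U" "(in_chart (immersion M) c has_derivative f') (at (snd c x))"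
    then show "norm (f' u) \<le> C * norm (L (f' u))"
      by (rule slope)
  qed
  have h0: "?h x0 = 0"
    using x0(2) linear_0[OF L(1)] by simp
  obtain s where s: "section_on ?X ?h ?K (ball 0 (a / C)) s" "s 0 = x0"
    using radial_section[OF X cont x0U h0 a(1) C(1) K KU ls intrinsic_dist_triangle] .
  have s': "section_on ?X ?h ?U (ball 0 (\<rho> / 2)) s"
    using s(1) KU unfolding section_on_def a(3) by blast
  have hS: "?h ` S \<subseteq> ball 0 (\<rho> / 2)"
  proof
    fix z assume "z \<in> ?h ` S"
    then obtain y where "y \<in> S" "z = ?h y"
      by blast
    then show "z \<in> ball 0 (\<rho> / 2)"
      using S(2) L(2)[of "immersion M y"] by (fastforce simp: subset_iff)
  qed
  have z0: "0 \<in> ball (0 :: real^2) (\<rho> / 2)" "s 0 \<in> S"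
    using \<rho>(1) S(3) s(2) by auto
  have "S \<subseteq> s ` ball 0 (\<rho> / 2)"
  proof (rule connected_subset_section_image[where h="?h" and U="?U"])
    show "locally_injective ?X ?h ?U"
      by (rule locally_sectioned_imp_locally_injective[OF ls])
  qed fact+
  moreover have "s ` ball 0 (\<rho> / 2) \<subseteq> ?U"
    using s' unfolding section_on_def by (elim conjE)
  ultimately show ?thesis
    by (rule subset_trans)
qed

end

section \<open>From the curvature bounds to the tilt bound on the component\<close>

lemma Lp_norm_H_mono:
  assumes "S \<subseteq> T" "p > 0"
  shows "Lp_norm_H M p S \<le> Lp_norm_H M p T"
proof -
  let ?I = "\<lambda>S. \<integral>\<^sup>+x\<in>S. ennreal (\<bar>mean_curv M x\<bar> powr p) \<partial>area M"
  have le: "?I S \<le> ?I T"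
    using assms(1) by (intro nn_integral_mono) (auto simp: indicator_def)
  show ?thesis
  proof (cases "?I T = \<infinity>")
    case False
    then have "?I S \<noteq> \<infinity>"
      using le by (auto simp: top_unique)
    moreover have "enn2real (?I S) \<le> enn2real (?I T)"
      using le False by (intro enn2real_mono) (auto simp: less_top)
    then have "enn2real (?I S) powr (1 / p) \<le> enn2real (?I T) powr (1 / p)"
      using assms(2) by (intro powr_mono2) auto
    ultimately show ?thesis
      using False by (simp add: Lp_norm_H_def ennreal_leI)
  qed (simp add: Lp_norm_H_def)
qed

theorem corollary1p4:
  fixes c1 \<beta> :: real and c2 :: "real \<Rightarrow> real"
    and p R r :: real and M :: "'a surface" and M\<^sub>R :: "'a set"
  assumes c1_pos: "c1 > 0"
    and beta: "0 < \<beta>" "\<beta> < 1/2"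
    and c2_pos: "\<And>q. q > 2 \<Longrightarrow> c2 q > 0"
    and constants: "\<And>(q::real) (\<rho>::real) (N::'a surface) x0 (s::real).
        q > 2 \<Longrightarrow> \<rho> > 0 \<Longrightarrow> compact_immersed_surface N \<Longrightarrow>
        x0 \<in> topspace (points N) \<Longrightarrow>
        intrinsic_ball N x0 \<rho> \<subseteq> topspace (points N) - surface_boundary N \<Longrightarrow>
        0 \<le> s \<Longrightarrow> s \<le> 1 \<Longrightarrow>
        integral_A_sq N (intrinsic_ball N x0 \<rho>) \<le> ennreal (c1 * s\<^sup>2) \<Longrightarrow>
        Lp_norm_H N q (intrinsic_ball N x0 \<rho>) * ennreal (\<rho> powr ((q - 2) / q))
          \<le> ennreal (c2 q * s) \<Longrightarrow>
        \<exists>Q. rotation_matrix Q \<and>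
          (SUP x\<in>intrinsic_ball N x0 (\<beta> * \<rho>). tilt (rotate_surface Q N) x) \<le> s"
    and p: "p > 2"
    and R: "R > 0"
    and M: "compact_immersed_surface M"
    and origin: "surface_preimage M {0} \<noteq> {}"
    and boundary: "immersion M ` surface_boundary M \<subseteq> sphere 0 R"
    and r: "0 \<le> r" "r \<le> 1 / sqrt 3"
    and A_small: "integral_A_sq M (topspace (points M)) \<le> ennreal (c1 * r\<^sup>2)"
    and H_small: "Lp_norm_H M p (surface_preimage M (ball 0 R)) * ennreal (R powr ((p - 2) / p))
          \<le> ennreal (c2 p * r)"
    and component: "M\<^sub>R \<in> connected_components_of
          (subtopology (points M) (surface_preimage M (ball 0 (\<beta> * R / 2))))"
    and origin_component: "M\<^sub>R \<inter> surface_preimage M {0} \<noteq> {}"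
  shows "\<exists>Q. rotation_matrix Q \<and> (SUP x\<in>M\<^sub>R. tilt (rotate_surface Q M) x) \<le> r"
proof -
  interpret surface M
    using M by unfold_locales (simp add: compact_immersed_surface_def)
  let ?X = "points M"
  have M\<^sub>R: "connectedin ?X M\<^sub>R" "M\<^sub>R \<subseteq> surface_preimage M (ball 0 (\<beta> * R / 2))"
    using connectedin_connected_components_of[OF component]
    by (auto simp: connectedin_subtopology)
  \<comment> \<open>The origin may have several preimages; the intrinsic ball must be centred at one
    that lies in \<open>M\<^sub>R\<close>.\<close>
  obtain x0 where x0: "x0 \<in> M\<^sub>R" "x0 \<in> topspace ?X" "immersion M x0 = 0"
    using origin_component by (auto simp: surface_preimage_def)
  have ball: "intrinsic_ball M x0 \<rho> \<subseteq> surface_preimage M (ball 0 R) - surface_boundary M" if "\<rho> \<le> R" for \<rho>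
  proof
    fix y assume y: "y \<in> intrinsic_ball M x0 \<rho>"
    then have "norm (immersion M y) < R"
      using immersion_norm_less[OF y x0(3)] that by simp
    then show "y \<in> surface_preimage M (ball 0 R) - surface_boundary M"
      using boundary y by (force simp: surface_preimage_def intrinsic_ball_def)
  qed
  have "1 / sqrt 3 \<le> (1::real)"
    by simp
  then have "r \<le> 1"
    using r(2) by linarith
  have "intrinsic_ball M x0 R \<subseteq> topspace ?X - surface_boundary M"
    using ball[of R] by (auto simp: surface_preimage_def)
  moreover have "integral_A_sq M (intrinsic_ball M x0 R) \<le> ennreal (c1 * r\<^sup>2)"
  proof (rule order_trans[OF _ A_small])
    show "integral_A_sq M (intrinsic_ball M x0 R) \<le> integral_A_sq M (topspace ?X)"
      unfolding integral_A_sq_def by (intro nn_integral_mono) (auto simp: indicator_def intrinsic_ball_def)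
  qed
  moreover have "Lp_norm_H M p (intrinsic_ball M x0 R) * ennreal (R powr ((p - 2) / p)) \<le> ennreal (c2 p * r)"
  proof (rule order_trans[OF _ H_small])
    have "Lp_norm_H M p (intrinsic_ball M x0 R) \<le> Lp_norm_H M p (surface_preimage M (ball 0 R))"
      using ball[of R] p by (intro Lp_norm_H_mono) auto
    then show "Lp_norm_H M p (intrinsic_ball M x0 R) * ennreal (R powr ((p - 2) / p))
        \<le> Lp_norm_H M p (surface_preimage M (ball 0 R)) * ennreal (R powr ((p - 2) / p))"
      by (rule mult_right_mono) simp
  qed
  ultimately obtain Q where Q: "rotation_matrix Q"
      and sup: "(SUP x\<in>intrinsic_ball M x0 (\<beta> * R). tilt (rotate_surface Q M) x) \<le> r"
    using constants[OF p R M x0(2) _ r(1) \<open>r \<le> 1\<close>] by blast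
  \<comment> \<open>A real supremum dominates the values only for a set bounded above, hence the
    appeal to \<open>tilt_bounds\<close>.\<close>
  have "bdd_above (tilt (rotate_surface Q M) ` intrinsic_ball M x0 (\<beta> * R))"
    using tilt_bounds(2) by (intro bdd_aboveI2)
  then have tilt_le: "tilt (rotate_surface Q M) x \<le> r" if "x \<in> intrinsic_ball M x0 (\<beta> * R)" for x
    using cSUP_upper[OF that] sup by (meson order_trans)
  have \<beta>R: "0 < \<beta> * R" "\<beta> * R < R"
    using beta R by simp_all
  have "M\<^sub>R \<subseteq> intrinsic_ball M x0 (\<beta> * R)"
  \<comment> \<open>The rotation sits in the linear map \<open>L\<close>, so the statement concerns
    intrinsic balls of \<open>M\<close> itself; 3/2 is the slope constant from
    \<open>rotated_tilt_slope\<close>.\<close>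
  proof (rule component_subset_intrinsic_ball[where L="\<lambda>w. proj12 (Q *v w)" and C="3/2"])
    show "compact_space ?X"
      using M by (simp add: compact_immersed_surface_def)
    show "linear (\<lambda>w. proj12 (Q *v w))"
      using linear_compose[OF matrix_vector_mul_linear[of Q] linear_proj12] by (simp add: o_def)
    show "norm (proj12 (Q *v w)) \<le> norm w" for w
      using norm_proj12_le[of "Q *v w"] by (simp add: norm_rotation[OF Q])
    show "immersion M ` M\<^sub>R \<subseteq> ball 0 (\<beta> * R / 2)"
      using M\<^sub>R(2) by (auto simp: surface_preimage_def)
    fix c x f' u
    assume c: "c \<in> atlas M" "x \<in> fst c" and x: "x \<in> intrinsic_ball M x0 (\<beta> * R)"
      and f': "(in_chart (immersion M) c has_derivative f') (at (snd c x))"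
    have "x \<in> surface_preimage M (ball 0 R) - surface_boundary M"
      using ball[OF less_imp_le[OF \<beta>R(2)]] x by blast
    then have "x \<in> topspace ?X" "x \<notin> surface_boundary M"
      by (auto simp: surface_preimage_def)
    moreover have "tilt (rotate_surface Q M) x \<le> 1 / sqrt 3"
      using tilt_le[OF x] r(2) by simp
    ultimately show "norm (f' u) \<le> 3/2 * norm (proj12 (Q *v f' u))"
      using rotated_tilt_slope[OF Q _ _ _ c f'] by blast
  qed (use x0 boundary \<beta>R M\<^sub>R in auto)
  then have "(SUP x\<in>M\<^sub>R. tilt (rotate_surface Q M) x) \<le> r"
    using x0(1) tilt_le by (intro cSUP_least) auto
  then show ?thesis
    using Q by blast
qed

end
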